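(* Consider the ternary quadratic forms $Q_{2a}=x^2+2y^2+5z^2+xz$, $Q_{2b}=x^2+3y^2+6z^2+xy+2yz$, $Q_{2c}=x^2+3y^2+7z^2+xy+xz$, $Q_{5a}=x^2+xz+2y^2+3yz+7z^2$, $Q_{5b}=x^2+2y^2+yz+7z^2$, $Q_{23}=x^2+2xz+2y^2+3yz+5z^2$, $Q_{29}=x^2+xz+2y^2+3yz+5z^2$, $Q_{31}=x^2+2xz+2y^2+yz+5z^2$. For $p\in\{2,5,23,29,31\}$, let $N$ be a squarefree positive integer coprime to $p$. Then: \begin{itemize} \item ($p=2$) if $19\mid N$ then $N$ is represented by $Q_{2a}$; if $31\mid N$ then $N$ is represented by $Q_{2b}$; if $37\mid N$ then $N$ is represented by $Q_{2c}$; \item ($p=5$) if $N\equiv 0,2\pmod 3$ or $N\equiv 3\pmod 4$ then $N$ is represented by $Q_{5a}$; if $N\equiv 0\pmod{11}$ or $N\equiv 1\pmod 4$ then $N$ is represented by $Q_{5b}$; \item ($p=23$) if $N\equiv 1\pmod 4$ then $N$ is represented by $Q_{23}$; \item ($p=29$) if $N\equiv 3\pmod 8$ then $N$ is represented by $Q_{29}$; \item ($p=31$) if $N\equiv 1\pmod 4$ then $N$ is represented by $Q_{31}$. \end{itemize}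
   Context: A form $Q$ represents $N$ if $Q(x,y,z)=N$ for some $(x,y,z)\in\mathbb{Z}^3$. *)

theory Defs
  imports "HOL-Number_Theory.Number_Theory" "HOL-Computational_Algebra.Squarefree"
begin

definition represents :: "(int \<Rightarrow> int \<Rightarrow> int \<Rightarrow> int) \<Rightarrow> int \<Rightarrow> bool" where
  "represents Q N \<longleftrightarrow> (\<exists>x y z. Q x y z = N)"

definition Q2a :: "int \<Rightarrow> int \<Rightarrow> int \<Rightarrow> int" where
  "Q2a x y z = x^2 + 2*y^2 + 5*z^2 + x*z"

definition Q2b :: "int \<Rightarrow> int \<Rightarrow> int \<Rightarrow> int" where
  "Q2b x y z = x^2 + 3*y^2 + 6*z^2 + x*y + 2*y*z"

definition Q2c :: "int \<Rightarrow> int \<Rightarrow> int \<Rightarrow> int" where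
  "Q2c x y z = x^2 + 3*y^2 + 7*z^2 + x*y + x*z"

definition Q5a :: "int \<Rightarrow> int \<Rightarrow> int \<Rightarrow> int" where
  "Q5a x y z = x^2 + x*z + 2*y^2 + 3*y*z + 7*z^2"

definition Q5b :: "int \<Rightarrow> int \<Rightarrow> int \<Rightarrow> int" where
  "Q5b x y z = x^2 + 2*y^2 + y*z + 7*z^2"

definition Q23 :: "int \<Rightarrow> int \<Rightarrow> int \<Rightarrow> int" where
  "Q23 x y z = x^2 + 2*x*z + 2*y^2 + 3*y*z + 5*z^2"

definition Q29 :: "int \<Rightarrow> int \<Rightarrow> int \<Rightarrow> int" where
  "Q29 x y z = x^2 + x*z + 2*y^2 + 3*y*z + 5*z^2"

definition Q31 :: "int \<Rightarrow> int \<Rightarrow> int \<Rightarrow> int" where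
  "Q31 x y z = x^2 + 2*x*z + 2*y^2 + y*z + 5*z^2"

end

theory Submission
  imports Defs "HOL-Analysis.Analysis" "HOL-Real_Asymp.Real_Asymp"
begin

text \<open>
  For \<open>D \<in> {2, 5, 23, 29, 31}\<close> the ternary forms of discriminant \<open>D\<close> form a single genus. Following
  Dirichlet, a form \<open>N x\<^sup>2 + s x z + a y\<^sup>2 + h y z + c z\<^sup>2\<close> of discriminant
  \<open>N (4 a c - h\<^sup>2) - a s\<^sup>2 = D\<close> is obtained by taking \<open>a\<close> to be a prime (or twice a prime) with
  prescribed quadratic characters modulo the primes dividing \<open>2 D N\<close>; only real characters are needed
  for this, and the primes are found by the elementary method of Mertens. For odd
  \<open>D\<close> and \<open>N \<equiv> -D (mod 4)\<close> one can take \<open>s\<close> even, so that the vector representing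
  \<open>N\<close> lies in the radical of the polar form modulo 2 and hence in all 2-neighbours of the lattice.

  Hermite reduction leaves finitely many forms of discriminant \<open>D\<close>. Each of them is related to the
  target form by rational similarities with small denominators (coming from neighbours at 2 and from sublattices at
  3, 11, 19, 31, 37), and for every residue class of the representing vector one of these similarities
  takes an integral value.
\<close>

subsection \<open>Real characters\<close>

text \<open>The targets for 2 and 5 have larger discriminants: 38, 62, 74, 45 and 55, that is
  \<open>D\<close> times 19, 31, 37, 9 and 11. A similarity with factor 19, 31, 37 or 11 carries
  every form of discriminant \<open>D\<close> into the target of that prime, so for \<open>N\<close>
  divisible by it the quotient only has to be represented by some form of discriminant
  \<open>D\<close>. The targets for 23, 29 and 31 do have discriminant \<open>D\<close>, but their
  genera contain several classes, and a representation by the genus must be steered to the right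
  one. The radical does this: for odd \<open>D\<close> it is spanned modulo 2 by the vector
  \<open>(r, s, t)\<close> of mixed coefficients. The value there is
  \<open>4 a b c + 4 r s t - D\<close>, and every vector in its class modulo 2 has the same value
  modulo 4. Hence \<open>N = -D\<close> modulo 4: the class 1 for 23 and 31, the class 3 for 5 and
  29. For \<open>Q5b\<close> with \<open>N = 1\<close> modulo 4 the construction is applied to
  \<open>11 * N\<close>, and a similarity then divides by 11.\<close>

text \<open>Abel's inequality. All cancellation in character sums against smooth weights enters
  through it.\<close>

lemma summation_by_parts_bound:
  fixes f g :: "nat \<Rightarrow> real"
  assumes "\<And>k. \<bar>\<Sum>n\<in>{u..<k}. f n\<bar> \<le> B"
    and dec: "\<And>n. n \<ge> u \<Longrightarrow> g (Suc n) \<le> g n" and nonneg: "\<And>n. n \<ge> u \<Longrightarrow> g n \<ge> 0"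
  shows "\<bar>\<Sum>n\<in>{u..<v}. f n * g n\<bar> \<le> B * g u"
proof (cases "u \<le> v")
  case True
  define A where "A k = (\<Sum>n\<in>{u..<k}. f n)" for k
  have A: "\<bar>A k\<bar> \<le> B" for k using assms(1) by (simp add: A_def)
  have "B \<ge> 0" using A[of u] by (simp add: A_def)
  have eq: "(\<Sum>n\<in>{u..<v}. f n * g n) = A v * g v + (\<Sum>n\<in>{u..<v}. A (Suc n) * (g n - g (Suc n)))"
    using True by (induction v rule: dec_induct) (simp_all add: A_def algebra_simps)
  have "\<bar>\<Sum>n\<in>{u..<v}. A (Suc n) * (g n - g (Suc n))\<bar> \<le> (\<Sum>n\<in>{u..<v}. \<bar>A (Suc n) * (g n - g (Suc n))\<bar>)"
    by (rule sum_abs)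
  also have "\<dots> \<le> (\<Sum>n\<in>{u..<v}. B * (g n - g (Suc n)))"
    using A dec \<open>B \<ge> 0\<close> by (intro sum_mono) (auto simp: abs_mult intro!: mult_mono)
  also have "\<dots> = B * (g u - g v)"
    using True by (induction v rule: dec_induct) (simp_all add: algebra_simps)
  finally have "\<bar>\<Sum>n\<in>{u..<v}. A (Suc n) * (g n - g (Suc n))\<bar> \<le> B * (g u - g v)" .
  moreover have "\<bar>A v * g v\<bar> \<le> B * g v"
    using A nonneg[OF True] \<open>B \<ge> 0\<close> by (auto simp: abs_mult intro!: mult_mono)
  ultimately show ?thesis unfolding eq by (simp add: algebra_simps)
next
  case False
  then show ?thesis using assms(1)[of u] nonneg[of u] by simp
qed

text \<open>Pairs \<open>(d, m)\<close> with \<open>d * m <= x\<close> are counted by their product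
  or by \<open>d\<close>; both the hyperbola method and Mertens' argument start here.\<close>

lemma sum_divisors_swap:
  fixes F :: "nat \<Rightarrow> nat \<Rightarrow> real"
  shows "(\<Sum>n\<in>{1..x}. \<Sum>d | d dvd n. F d (n div d)) = (\<Sum>d\<in>{1..x}. \<Sum>m\<in>{1..x div d}. F d m)"
proof -
  have fin: "\<forall>n\<in>{1..x}. finite {d. d dvd n}" by auto
  show ?thesis
    unfolding sum.Sigma[OF finite_atLeastAtMost fin] 
    by (subst sum.Sigma; (simp; fail)?)
      (rule sum.reindex_bij_witness[of _ "\<lambda>(d,m). (d * m, d)" "\<lambda>(n,d). (d, n div d)"];
       fastforce simp: less_eq_div_iff_mult_less_eq Suc_le_eq mult.commute div_greater_zero_iff
         dest: dvd_imp_le intro: dvd_pos_nat div_le_mono)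
qed

lemma sum_divisors_coprime:
  fixes F :: "nat \<Rightarrow> real"
  assumes "coprime a b" "a > 0" "b > 0"
  shows "(\<Sum>d | d dvd a * b. F d) = (\<Sum>d | d dvd a. \<Sum>e | e dvd b. F (d * e))"
proof -
  have "(\<Sum>d | d dvd a. \<Sum>e | e dvd b. F (d * e)) = (\<Sum>(d,e)\<in>{d. d dvd a} \<times> {e. e dvd b}. F (d * e))"
    by (simp add: sum.cartesian_product)
  also have "\<dots> = (\<Sum>p\<in>{d. d dvd a} \<times> {e. e dvd b}. F (fst p * snd p))"
    by (simp add: case_prod_unfold)
  also have "\<dots> = (\<Sum>d | d dvd a * b. F d)"
  proof (rule sum.reindex_bij_betw[where h = "\<lambda>p. fst p * snd p"])
    show "bij_betw (\<lambda>p. fst p * snd p) ({d. d dvd a} \<times> {e. e dvd b}) {d. d dvd a * b}"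
      unfolding bij_betw_def
    proof
      show "inj_on (\<lambda>p. fst p * snd p) ({d. d dvd a} \<times> {e. e dvd b})"
      proof (rule inj_onI, clarsimp)
        fix d e d' e' assume *: "d dvd a" "e dvd b" "d' dvd a" "e' dvd b" "d * e = d' * e'"
        have cop: "coprime d e'" "coprime d' e" using * assms(1) by (meson coprime_divisors)+
        have "d dvd d'" "d' dvd d"
          using *(5) cop by (metis coprime_dvd_mult_left_iff dvd_triv_left)+
        then have "d = d'" by (rule dvd_antisym)
        moreover have "d > 0" using *(1) assms(2) by (auto intro: Nat.gr0I)
        ultimately show "d = d' \<and> e = e'" using *(5) by simp
      qed
      show "(\<lambda>p. fst p * snd p) ` ({d. d dvd a} \<times> {e. e dvd b}) = {d. d dvd a * b}"
        by (auto simp: mult_dvd_mono image_iff) (meson division_decomp)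
    qed
  qed
  finally show ?thesis by simp
qed

text \<open>A nonprincipal real Dirichlet character. Nonprincipality is expressed by the value -1:
  multiplication by such an argument permutes the residues and flips the sign of their sum, which is
  therefore 0.\<close>

locale real_character =
  fixes f :: "nat \<Rightarrow> real" and M :: nat
  assumes modulus_pos: "M > 0"
    and mult: "f (m * n) = f m * f n"
    and periodic: "f (n + M) = f n"
    and range: "f n \<in> {-1, 0, 1}"
    and one: "f 1 = 1"
    and not_coprime: "\<not> coprime n M \<Longrightarrow> f n = 0"
    and nonprincipal: "\<exists>n. f n = -1"
begin

lemma abs_le_1: "\<bar>f n\<bar> \<le> 1"
  using range[of n] by auto

lemma periodic_mult: "f (n + k * M) = f n"
proof (induction k)
  case (Suc k)
  then show ?case using periodic[of "n + k * M"] by (simp add: algebra_simps)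
qed simp

lemma mod_modulus: "f (n mod M) = f n"
  using periodic_mult[of "n mod M" "n div M"] by simp

lemma sum_period: "(\<Sum>n<M. f n) = 0"
proof -
  obtain k where k: "f k = -1" using nonprincipal by blast
  then have cop: "coprime k M" using not_coprime[of k] by force
  have "(\<Sum>n<M. f n) = (\<Sum>n<M. f (k * n mod M))"
  proof (rule sum.reindex_bij_betw[symmetric])
    have inj: "inj_on (\<lambda>n. k * n mod M) {..<M}"
    proof (rule inj_onI)
      fix x y assume "x \<in> {..<M}" "y \<in> {..<M}" "k * x mod M = k * y mod M"
      then have "x < M" "y < M" "[k * x = k * y] (mod M)"
        by (auto simp: Cong.cong_def)
      then show "x = y"
        using cong_mult_lcancel_nat[OF cop, of x y] cong_less_modulus_unique_nat by blast
    qed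
    have "(\<lambda>n. k * n mod M) ` {..<M} \<subseteq> {..<M}" using modulus_pos by auto
    then show "bij_betw (\<lambda>n. k * n mod M) {..<M} {..<M}"
      using inj by (simp add: bij_betw_def endo_inj_surj)
  qed
  also have "\<dots> = - (\<Sum>n<M. f n)"
    by (simp add: mod_modulus mult k sum_negf)
  finally show ?thesis by simp
qed

text \<open>Full periods cancel wherever they start, so only one incomplete period is left.\<close>

lemma partial_sum_bound: "\<bar>\<Sum>n\<in>{u..<v}. f n\<bar> \<le> M"
proof -
  have block: "(\<Sum>n\<in>{u..<u+M}. f n) = 0" for u
  proof (induction u)
    case 0
    then show ?case using sum_period by (simp add: atLeast0LessThan)
  next
    case (Suc u)
    have "(\<Sum>n\<in>{u..<u+M}. f n) + f (u + M) = f u + (\<Sum>n\<in>{Suc u..<Suc u+M}. f n)"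
      using modulus_pos
      by (metis add_Suc le_add1 sum.atLeastLessThan_Suc sum.atLeast_Suc_lessThan le_imp_less_Suc)
    then show ?case using Suc periodic by simp
  qed
  show ?thesis
  proof (induction "v - u" arbitrary: u rule: less_induct)
    case less
    show ?case
    proof (cases "v < u + M")
      case True
      have "\<bar>\<Sum>n\<in>{u..<v}. f n\<bar> \<le> (\<Sum>n\<in>{u..<v}. 1)"
        by (rule order.trans[OF sum_abs]) (intro sum_mono abs_le_1)
      then show ?thesis using True by simp
    next
      case False
      then have "(\<Sum>n\<in>{u..<v}. f n) = (\<Sum>n\<in>{u..<u+M}. f n) + (\<Sum>n\<in>{u+M..<v}. f n)"
        by (intro sum.atLeastLessThan_concat[symmetric]) auto
      moreover have "v - (u + M) < v - u" using False modulus_pos by linarith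
      ultimately show ?thesis using less[of "u + M"] block by simp
    qed
  qed
qed

lemma weighted_sum_bound:
  fixes g :: "nat \<Rightarrow> real"
  assumes "\<And>n. n \<ge> u \<Longrightarrow> g (Suc n) \<le> g n" "\<And>n. n \<ge> u \<Longrightarrow> g n \<ge> 0"
  shows "\<bar>\<Sum>n\<in>{u..<v}. f n * g n\<bar> \<le> M * g u"
  using assms partial_sum_bound by (intro summation_by_parts_bound) auto

definition L where "L = lim (\<lambda>x. \<Sum>n\<in>{1..x}. f n / real n)"

lemma L_approx: "\<bar>L - (\<Sum>n\<in>{1..x}. f n / real n)\<bar> \<le> M / real (Suc x)"
proof -
  define S where "S x = (\<Sum>n\<in>{1..x}. f n / real n)" for x
  have diff: "\<bar>S v - S u\<bar> \<le> M / real (Suc u)" if "v \<ge> u" for u v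
  proof -
    have "S v - S u = (\<Sum>n\<in>{Suc u..<Suc v}. f n / real n)"
      using that unfolding S_def atLeastLessThanSuc_atLeastAtMost
      by (induction v rule: dec_induct) auto
    then show ?thesis
      using weighted_sum_bound[of "Suc u" "\<lambda>n. 1 / real n" "Suc v"] by (simp add: field_simps)
  qed
  have "Cauchy S"
  proof (rule CauchyI')
    fix e :: real assume "e > 0"
    obtain m :: nat where m: "real m > M / e" using reals_Archimedean2 by blast
    show "\<exists>m. \<forall>k\<ge>m. \<forall>n>k. dist (S k) (S n) < e"
    proof (intro exI[of _ m] allI impI)
      fix k n assume kn: "m \<le> k" "k < n"
      have "dist (S k) (S n) \<le> M / real (Suc k)" using diff[of k n] kn by (simp add: dist_real_def abs_minus_commute)
      also have "M / real (Suc k) < e"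
      proof -
        have "M < e * real m" using m \<open>e > 0\<close> by (simp add: field_simps)
        also have "\<dots> \<le> e * real (Suc k)" using kn \<open>e > 0\<close> by (intro mult_left_mono) auto
        finally show ?thesis by (simp add: field_simps)
      qed
      finally show "dist (S k) (S n) < e" .
    qed
  qed
  then have lim: "S \<longlonglongrightarrow> L"
    by (simp add: L_def S_def[abs_def] Cauchy_convergent_iff convergent_LIMSEQ_iff)
  have "(\<lambda>v. \<bar>S v - S x\<bar>) \<longlonglongrightarrow> \<bar>L - S x\<bar>"
    by (intro tendsto_intros lim)
  then have "\<bar>L - S x\<bar> \<le> M / real (Suc x)"
    by (rule LIMSEQ_le_const2) (use diff in blast)
  then show ?thesis by (simp add: S_def)
qed

text \<open>The divisor sum is multiplicative. At \<open>p ^ k\<close> it is the sum of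
  \<open>f p ^ i\<close> for \<open>i <= k\<close>: 1 if \<open>f p\<close> is 0,
  \<open>k + 1\<close> if it is 1, and alternately 1 and 0 if it is -1. Only the last case with odd
  \<open>k\<close> gives 0, and squares avoid it.\<close>

lemma divisor_sum_nonneg:
  assumes "n > 0"
  shows "(\<Sum>d | d dvd n. f d) \<ge> 0 \<and>
    ((\<forall>p. prime p \<longrightarrow> even (multiplicity p n)) \<longrightarrow> (\<Sum>d | d dvd n. f d) \<ge> 1)"
  using assms
proof (induction n rule: less_induct)
  case (less n)
  show ?case
  proof (cases "n = 1")
    case True
    then show ?thesis using one by simp
  next
    case False
    then obtain p where p: "prime p" "p dvd n" using prime_factor_nat by blast
    define k where "k = multiplicity p n"
    obtain m where m: "n = p ^ k * m" "\<not> p dvd m"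
      using multiplicity_decompose'[of n p] less.prems p unfolding k_def by (metis not_gr_zero not_prime_unit)
    have "k > 0" using p less.prems by (simp add: k_def prime_multiplicity_gt_zero_iff)
    have "m > 0" using m less.prems by (auto intro: Nat.gr0I)
    have "p ^ k > 1" using \<open>k > 0\<close> p by (intro one_less_power prime_gt_1_nat)
    then have "m < n" using m \<open>m > 0\<close> by simp
    have cop: "coprime (p ^ k) m"
      using p m by (simp add: prime_imp_coprime)
    have pk: "{d. d dvd p ^ k} = (\<lambda>i. p ^ i) ` {..k}"
      using p by (auto simp: divides_primepow_nat)
    have "inj_on (\<lambda>i. p ^ i) {..k}"
      using prime_gt_1_nat[OF p(1)] by (auto intro!: inj_onI)
    then have "(\<Sum>d | d dvd p ^ k. f d) = (\<Sum>i\<le>k. f (p ^ i))"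
      unfolding pk by (simp add: sum.reindex)
    also have "\<dots> = (\<Sum>i\<le>k. f p ^ i)"
    proof (rule sum.cong)
      show "f (p ^ i) = f p ^ i" for i by (induction i) (use one mult in auto)
    qed simp
    finally have sp: "(\<Sum>d | d dvd p ^ k. f d) = (\<Sum>i\<le>k. f p ^ i)" .
    have alt: "(\<Sum>i\<le>k. (-1) ^ i) = (if even k then 1 else 0 :: real)"
      by (induction k) auto
    have zero: "(\<Sum>i\<le>k. 0 ^ i) = (1 :: real)"
      by (induction k) auto
    have pos: "(\<Sum>i\<le>k. f p ^ i) \<ge> 0" "even k \<Longrightarrow> (\<Sum>i\<le>k. f p ^ i) \<ge> 1"
      using range[of p] by (auto simp: alt zero)
    have prod: "(\<Sum>d | d dvd n. f d) = (\<Sum>d | d dvd p ^ k. f d) * (\<Sum>d | d dvd m. f d)"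
      unfolding m(1) using cop p \<open>m > 0\<close>
      by (subst sum_divisors_coprime) (auto simp: mult sum_product prime_gt_0_nat)
    have IH: "(\<Sum>d | d dvd m. f d) \<ge> 0"
      "(\<forall>q. prime q \<longrightarrow> even (multiplicity q m)) \<Longrightarrow> (\<Sum>d | d dvd m. f d) \<ge> 1"
      using less.IH[OF \<open>m < n\<close> \<open>m > 0\<close>] by auto
    have "(\<Sum>d | d dvd n. f d) \<ge> 1" if ev: "\<forall>q. prime q \<longrightarrow> even (multiplicity q n)"
    proof -
      have "even (multiplicity q m)" if "prime q" for q
      proof (cases "q = p")
        case True
        then show ?thesis using m(2) by (simp add: not_dvd_imp_multiplicity_0)
      next
        case False
        then have "multiplicity q n = multiplicity q m"
          unfolding m(1) using that p \<open>m > 0\<close>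
          by (subst prime_elem_multiplicity_mult_distrib)
            (auto simp: multiplicity_distinct_prime_power prime_gt_0_nat)
        then show ?thesis using ev that by metis
      qed
      then have "1 * 1 \<le> (\<Sum>i\<le>k. f p ^ i) * (\<Sum>d | d dvd m. f d)"
        using pos ev p IH unfolding k_def by (intro mult_mono) auto
      then show ?thesis by (simp add: prod sp)
    qed
    then show ?thesis using IH pos by (simp add: prod sp)
  qed
qed

end

section \<open>Partial sums of inverse square roots\<close>

definition inv_sqrt_sum :: "nat \<Rightarrow> real" where
  "inv_sqrt_sum k = (\<Sum>m\<in>{1..k}. 1 / sqrt (real m))"

lemma sqrt_step:
  fixes k :: nat
  assumes "k > 0"
  shows "1 / sqrt (real (Suc k)) \<le> 2 * sqrt (real (Suc k)) - 2 * sqrt (real k)"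
    and "2 * sqrt (real (Suc k)) - 2 * sqrt (real k) \<le> 1 / sqrt (real k)"
proof -
  define a b where "a = sqrt (real k)" and "b = sqrt (real (Suc k))"
  have "a > 0" "a \<le> b" using assms by (auto simp: a_def b_def)
  have eq: "(b - a) * (b + a) = 1"
    using square_diff_square_factored[of b a] by (simp add: a_def b_def mult.commute)
  have "1 = (b - a) * (b + a)" using eq by simp
  also have "\<dots> \<le> (b - a) * (2 * b)" using \<open>a \<le> b\<close> by (intro mult_left_mono) auto
  finally show "1 / b \<le> 2 * b - 2 * a" using \<open>a > 0\<close> \<open>a \<le> b\<close> by (simp add: field_simps)
  have "(b - a) * (2 * a) \<le> (b - a) * (b + a)" using \<open>a \<le> b\<close> by (intro mult_left_mono) auto
  then show "2 * b - 2 * a \<le> 1 / a" using eq \<open>a > 0\<close> by (simp add: field_simps)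
qed

lemma inv_sqrt_sum_le: "inv_sqrt_sum k \<le> 2 * sqrt (real k)"
proof (induction k)
  case (Suc k)
  show ?case
  proof (cases "k = 0")
    case False
    then show ?thesis using Suc sqrt_step(1)[of k] by (simp add: inv_sqrt_sum_def)
  qed (simp add: inv_sqrt_sum_def)
qed (simp add: inv_sqrt_sum_def)

text \<open>The constant is zeta(1/2). The differences \<open>u\<close> decrease, but become
  increasing after subtraction of the inverse square root; both sequences have the limit
  \<open>c\<close>, which is thereby enclosed.\<close>

lemma inv_sqrt_sum_asymptotic:
  obtains c where "\<And>k. k > 0 \<Longrightarrow> \<bar>inv_sqrt_sum k - 2 * sqrt (real k) - c\<bar> \<le> 1 / sqrt (real k)"
proof -
  define u where "u k = inv_sqrt_sum (Suc k) - 2 * sqrt (real (Suc k))" for k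
  have step: "u (Suc k) - u k = 1 / sqrt (real (Suc (Suc k))) - (2 * sqrt (real (Suc (Suc k))) - 2 * sqrt (real (Suc k)))" for k
    by (simp add: u_def inv_sqrt_sum_def)
  have dec: "u (Suc k) \<le> u k" for k
    using step[of k] sqrt_step(1)[of "Suc k"] by simp
  have inc: "u k - 1 / sqrt (real (Suc k)) \<le> u (Suc k) - 1 / sqrt (real (Suc (Suc k)))" for k
    using step[of k] sqrt_step(2)[of "Suc k"] by simp
  have u_dec: "decseq u" using dec by (rule decseq_SucI)
  have u_inc: "incseq (\<lambda>k. u k - 1 / sqrt (real (Suc k)))" using inc by (rule incseq_SucI)
  have lower: "u k \<ge> u 0 - 1" for k
  proof -
    have "u 0 - 1 \<le> u k - 1 / sqrt (real (Suc k))" using incseqD[OF u_inc, of 0 k] by simp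
    also have "\<dots> \<le> u k" by simp
    finally show ?thesis .
  qed
  obtain c where c: "u \<longlonglongrightarrow> c" "\<And>k. c \<le> u k"
    using decseq_convergent[OF u_dec, of "u 0 - 1"] lower by blast
  have "(\<lambda>k. 1 / sqrt (real (Suc k))) \<longlonglongrightarrow> 0"
    by real_asymp
  then have lim: "(\<lambda>k. u k - 1 / sqrt (real (Suc k))) \<longlonglongrightarrow> c"
    using tendsto_diff[OF c(1)] by fastforce
  have le: "u k - 1 / sqrt (real (Suc k)) \<le> c" for k
    using incseq_le[OF u_inc lim] .
  show thesis
  proof (rule that[of c])
    fix k :: nat assume "k > 0"
    then obtain j where "k = Suc j" by (cases k) auto
    then show "\<bar>inv_sqrt_sum k - 2 * sqrt (real k) - c\<bar> \<le> 1 / sqrt (real k)"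
      using le[of j] c(2)[of j] by (simp add: u_def)
  qed
qed

context real_character
begin

text \<open>The divisor sums of \<open>f\<close> are nonnegative and at least 1 at squares, so weighted by \<open>1 / sqrt n\<close> they sum
  to infinity; the hyperbola method bounds this sum if \<open>L = 0\<close>.\<close>

lemma L_nonzero: "L \<noteq> 0"
proof
  assume L0: "L = 0"
  obtain c where c: "\<And>k. k > 0 \<Longrightarrow> \<bar>inv_sqrt_sum k - 2 * sqrt (real k) - c\<bar> \<le> 1 / sqrt (real k)"
    using inv_sqrt_sum_asymptotic by blast
  define r where "r n = (\<Sum>d | d dvd n. f d)" for n
  define F where "F d m = f d / sqrt (real d) * (1 / sqrt (real m))" for d m :: nat
  have upper: "harm x \<le> 4 * real M + \<bar>c\<bar> * M + 4" if "x > 0" for x :: nat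
  proof -
    \<comment> \<open>With a square as cutoff, every pair with \<open>d * m <= X\<close> has
      \<open>d <= x\<close> or \<open>m <= x\<close>.\<close>
    define X where "X = x\<^sup>2"
    have "X > 0" using that by (simp add: X_def)
    have sqX: "sqrt (real X) = x" by (simp add: X_def)
    have "x \<le> X" using that by (simp add: X_def power2_eq_square)
    have "harm x = (\<Sum>k\<in>{1..x}. 1 / sqrt (real (k\<^sup>2)))"
      by (simp add: harm_def divide_inverse)
    also have "\<dots> = (\<Sum>n\<in>(\<lambda>k. k\<^sup>2) ` {1..x}. 1 / sqrt (real n))"
      by (subst sum.reindex) (auto intro!: inj_onI)
    also have "\<dots> \<le> (\<Sum>n\<in>(\<lambda>k. k\<^sup>2) ` {1..x}. r n / sqrt (real n))"
    proof (rule sum_mono)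
      fix n assume "n \<in> (\<lambda>k. k\<^sup>2) ` {1..x}"
      then obtain k where k: "n = k\<^sup>2" "k > 0" by auto
      have "even (multiplicity p n)" if "prime p" for p
        using that k by (simp add: prime_elem_multiplicity_power_distrib)
      then have "r n \<ge> 1" using divisor_sum_nonneg[of n] k by (simp add: r_def)
      then show "1 / sqrt (real n) \<le> r n / sqrt (real n)" by (simp add: divide_right_mono)
    qed
    also have "\<dots> \<le> (\<Sum>n\<in>{1..X}. r n / sqrt (real n))"
      using divisor_sum_nonneg
      by (intro sum_mono2) (auto simp: r_def X_def power_mono)
    also have "\<dots> = (\<Sum>n\<in>{1..X}. \<Sum>d | d dvd n. F d (n div d))"
    proof (rule sum.cong[OF refl])
      fix n assume n: "n \<in> {1..X}"
      have "r n / sqrt (real n) = (\<Sum>d | d dvd n. f d / sqrt (real n))"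
        by (simp add: r_def sum_divide_distrib)
      also have "\<dots> = (\<Sum>d | d dvd n. F d (n div d))"
      proof (rule sum.cong[OF refl])
        fix d assume "d \<in> {d. d dvd n}"
        then have "real n = real d * real (n div d)" by (simp flip: of_nat_mult)
        then show "f d / sqrt (real n) = F d (n div d)"
          by (simp add: F_def real_sqrt_mult)
      qed
      finally show "r n / sqrt (real n) = (\<Sum>d | d dvd n. F d (n div d))" .
    qed
    also have "\<dots> = (\<Sum>d\<in>{1..X}. \<Sum>m\<in>{1..X div d}. F d m)"
      by (rule sum_divisors_swap)
    also have "\<dots> = (\<Sum>d\<in>{1..x}. \<Sum>m\<in>{1..X div d}. F d m) + (\<Sum>d\<in>{x<..X}. \<Sum>m\<in>{1..X div d}. F d m)"
    proof -
      have split: "{1..X} = {1..x} \<union> {x<..X}" using \<open>x \<le> X\<close> by auto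
      have "sum G {1..X} = sum G {1..x} + sum G {x<..X}" for G :: "nat \<Rightarrow> real"
        unfolding split by (rule sum.union_disjoint) auto
      then show ?thesis .
    qed
    \<comment> \<open>For large \<open>d\<close> the order is exchanged, so that for fixed
      \<open>m <= x\<close> the inner sum runs over \<open>d\<close> and the cancellation of
      \<open>f\<close> applies.\<close>
    also have "(\<Sum>d\<in>{x<..X}. \<Sum>m\<in>{1..X div d}. F d m) = (\<Sum>m\<in>{1..x}. \<Sum>d\<in>{x<..X div m}. F d m)"
    proof -
      have bound: "m \<le> x" if "x < d" "m * d \<le> X" for m d
      proof (rule ccontr)
        assume "\<not> m \<le> x"
        then have "x * x < m * d" using that by (intro mult_strict_mono) auto
        then show False using that by (simp add: X_def power2_eq_square)
      qed
      have le: "d \<le> X" if "d \<le> X div m" for d m :: nat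
        using that div_le_dividend order.trans by blast
      have "(\<Sum>d\<in>{x<..X}. \<Sum>m\<in>{1..X div d}. F d m) = (\<Sum>d\<in>{x<..X}. \<Sum>m\<in>{m \<in> {1..x}. d * m \<le> X}. F d m)"
      proof (rule sum.cong[OF refl])
        fix d assume "d \<in> {x<..X}"
        then have "{1..X div d} = {m \<in> {1..x}. d * m \<le> X}"
          using bound[of d] by (auto simp: less_eq_div_iff_mult_less_eq mult.commute)
        then show "(\<Sum>m\<in>{1..X div d}. F d m) = (\<Sum>m\<in>{m \<in> {1..x}. d * m \<le> X}. F d m)" by (rule arg_cong)
      qed
      also have "\<dots> = (\<Sum>m\<in>{1..x}. \<Sum>d\<in>{d \<in> {x<..X}. d * m \<le> X}. F d m)"
        by (rule sum.swap_restrict) auto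
      also have "\<dots> = (\<Sum>m\<in>{1..x}. \<Sum>d\<in>{x<..X div m}. F d m)"
      proof (rule sum.cong[OF refl])
        fix m assume "m \<in> {1..x}"
        then have "{d \<in> {x<..X}. d * m \<le> X} = {x<..X div m}"
          using le[of _ m] by (auto simp: less_eq_div_iff_mult_less_eq)
        then show "(\<Sum>d\<in>{d \<in> {x<..X}. d * m \<le> X}. F d m) = (\<Sum>d\<in>{x<..X div m}. F d m)" by (rule arg_cong)
      qed
      finally show ?thesis .
    qed
    finally have main: "harm x \<le> (\<Sum>d\<in>{1..x}. \<Sum>m\<in>{1..X div d}. F d m) + (\<Sum>m\<in>{1..x}. \<Sum>d\<in>{x<..X div m}. F d m)" .
    have part2: "(\<Sum>m\<in>{1..x}. \<Sum>d\<in>{x<..X div m}. F d m) \<le> 2 * real M"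
    proof -
      have "(\<Sum>m\<in>{1..x}. \<Sum>d\<in>{x<..X div m}. F d m) \<le> (\<Sum>m\<in>{1..x}. (M / sqrt (real x)) * (1 / sqrt (real m)))"
      proof (rule sum_mono)
        fix m assume m: "m \<in> {1..x}"
        have "(\<Sum>d\<in>{x<..X div m}. F d m) = (\<Sum>d\<in>{Suc x..<Suc (X div m)}. f d * (1 / sqrt (real d))) * (1 / sqrt (real m))"
          by (simp add: F_def sum_divide_distrib atLeastLessThanSuc_atLeastAtMost atLeastSucAtMost_greaterThanAtMost)
        also have "\<dots> \<le> (M / sqrt (real x)) * (1 / sqrt (real m))"
        proof (rule mult_right_mono)
          have "\<bar>\<Sum>d\<in>{Suc x..<Suc (X div m)}. f d * (1 / sqrt (real d))\<bar> \<le> M * (1 / sqrt (real (Suc x)))"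
            by (rule weighted_sum_bound) (auto simp: field_simps)
          also have "\<dots> \<le> M * (1 / sqrt (real x))"
            using that by (intro mult_left_mono) (auto simp: field_simps)
          finally show "(\<Sum>d\<in>{Suc x..<Suc (X div m)}. f d * (1 / sqrt (real d))) \<le> M / sqrt (real x)" by simp
        qed simp
        finally show "(\<Sum>d\<in>{x<..X div m}. F d m) \<le> (M / sqrt (real x)) * (1 / sqrt (real m))" .
      qed
      also have "\<dots> = (M / sqrt (real x)) * inv_sqrt_sum x"
        by (simp add: inv_sqrt_sum_def sum_distrib_left)
      also have "\<dots> \<le> (M / sqrt (real x)) * (2 * sqrt (real x))"
        by (intro mult_left_mono inv_sqrt_sum_le) auto
      also have "\<dots> = 2 * real M" using that by simp
      finally show ?thesis .
    qed
    \<comment> \<open>For small \<open>d\<close> the sum over \<open>m\<close> is replaced by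
      \<open>2 * sqrt (X / d) + c\<close>. Its leading part yields \<open>2 * x\<close> times a
      partial sum of the series for \<open>L\<close>; as \<open>L = 0\<close>, only the tail of that
      series survives and the product stays bounded.\<close>
    have part1: "(\<Sum>d\<in>{1..x}. \<Sum>m\<in>{1..X div d}. F d m) \<le> 2 * real M + \<bar>c\<bar> * M + 4"
    proof -
      define e where "e d = inv_sqrt_sum (X div d) - 2 * (real x / sqrt (real d)) - c" for d
      have e: "\<bar>e d\<bar> \<le> 4 * sqrt (real d) / x" if d: "d \<in> {1..x}" for d
      proof -
        define k where "k = X div d"
        define y where "y = real X / real d"
        have "d > 0" using d by simp
        have "k > 0" using d \<open>x \<le> X\<close> by (auto simp: k_def div_greater_zero_iff)
        have "\<lfloor>y\<rfloor> = int k" by (simp add: y_def k_def floor_divide_of_nat_eq)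
        then have ky: "real k \<le> y" and yk: "y \<le> real k + 1" by linarith+
        have "y > 0" using ky \<open>k > 0\<close> by linarith
        have sqy: "sqrt y = real x / sqrt (real d)" by (simp add: y_def real_sqrt_divide sqX)
        have inv: "1 / sqrt y = sqrt (real d) / x" by (simp add: sqy)
        have 1: "\<bar>inv_sqrt_sum k - 2 * sqrt (real k) - c\<bar> \<le> 1 / sqrt (real k)"
          using c \<open>k > 0\<close> by blast
        \<comment> \<open>\<open>y / 4 <= k\<close> follows from \<open>y <= k + 1\<close> and
          \<open>k >= 1\<close>; the divisor 4 has a rational square root.\<close>
        have "1 / sqrt (real k) \<le> 1 / sqrt (y / 4)"
          using yk \<open>k > 0\<close> \<open>y > 0\<close> by (intro divide_left_mono real_sqrt_le_mono mult_pos_pos) auto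
        also have "\<dots> = 2 * (1 / sqrt y)" by (simp add: real_sqrt_divide)
        finally have 2: "1 / sqrt (real k) \<le> 2 * (1 / sqrt y)" .
        have "(sqrt y - sqrt k) * (sqrt y + sqrt k) = y - k"
          using \<open>y > 0\<close> square_diff_square_factored[of "sqrt y" "sqrt (real k)"] by (simp add: mult.commute)
        moreover have "(sqrt y - sqrt k) * (sqrt y + sqrt k) \<ge> (sqrt y - sqrt k) * sqrt y"
          using ky by (intro mult_left_mono) auto
        ultimately have "(sqrt y - sqrt k) * sqrt y \<le> 1" using yk by linarith
        then have 3: "sqrt y - sqrt k \<le> 1 / sqrt y" using \<open>y > 0\<close> by (simp add: field_simps)
        have 4: "sqrt k \<le> sqrt y" using ky by simp
        have "\<bar>inv_sqrt_sum k - 2 * sqrt y - c\<bar> \<le> 4 * (1 / sqrt y)"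
          using 1 2 3 4 by linarith
        then show ?thesis by (simp add: e_def k_def sqy)
      qed
      have "(\<Sum>d\<in>{1..x}. \<Sum>m\<in>{1..X div d}. F d m) = (\<Sum>d\<in>{1..x}. f d / sqrt (real d) * inv_sqrt_sum (X div d))"
        by (simp add: F_def inv_sqrt_sum_def sum_distrib_left)
      also have "\<dots> = (\<Sum>d\<in>{1..x}. 2 * x * (f d / d) + c * (f d * (1 / sqrt (real d))) + f d / sqrt (real d) * e d)"
      proof (rule sum.cong[OF refl])
        fix d assume "d \<in> {1..x}"
        have h: "inv_sqrt_sum (X div d) = 2 * (real x / sqrt (real d)) + c + e d" by (simp add: e_def)
        have "f d / sqrt (real d) * (2 * (real x / sqrt (real d))) = 2 * x * (f d / (sqrt (real d) * sqrt (real d)))"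
          by (simp add: field_simps)
        also have "\<dots> = 2 * x * (f d / d)" by simp
        finally show "f d / sqrt (real d) * inv_sqrt_sum (X div d) = 
            2 * x * (f d / d) + c * (f d * (1 / sqrt (real d))) + f d / sqrt (real d) * e d"
          unfolding h by (simp add: algebra_simps)
      qed
      also have "\<dots> = 2 * x * (\<Sum>d\<in>{1..x}. f d / d) + c * (\<Sum>d\<in>{1..x}. f d * (1 / sqrt (real d)))
          + (\<Sum>d\<in>{1..x}. f d / sqrt (real d) * e d)"
        by (simp add: sum.distrib sum_distrib_left)
      also have "\<dots> \<le> 2 * real M + \<bar>c\<bar> * M + 4"
      proof (intro add_mono)
        have "2 * x * (\<Sum>d\<in>{1..x}. f d / d) \<le> 2 * x * (M / real (Suc x))"
          using L_approx[of x] by (intro mult_left_mono) (auto simp: L0)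
        also have "\<dots> \<le> 2 * M" by (simp add: field_simps)
        finally show "2 * x * (\<Sum>d\<in>{1..x}. f d / d) \<le> 2 * real M" by simp
        have "\<bar>\<Sum>d\<in>{1..<Suc x}. f d * (1 / sqrt (real d))\<bar> \<le> M * (1 / sqrt (real 1))"
          by (rule weighted_sum_bound) (auto simp: field_simps)
        then have "\<bar>c * (\<Sum>d\<in>{1..x}. f d * (1 / sqrt (real d)))\<bar> \<le> \<bar>c\<bar> * M"
          by (simp add: abs_mult mult_left_mono atLeastLessThanSuc_atLeastAtMost)
        then show "c * (\<Sum>d\<in>{1..x}. f d * (1 / sqrt (real d))) \<le> \<bar>c\<bar> * M" by linarith
        have "(\<Sum>d\<in>{1..x}. f d / sqrt (real d) * e d) \<le> (\<Sum>d\<in>{1..x}. 4 / real x)"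
        proof (rule sum_mono)
          fix d assume d: "d \<in> {1..x}"
          have "f d / sqrt (real d) * e d \<le> \<bar>f d / sqrt (real d)\<bar> * \<bar>e d\<bar>"
            by (metis abs_ge_self abs_mult)
          also have "\<dots> \<le> (1 / sqrt (real d)) * (4 * sqrt (real d) / x)"
            using e[OF d] abs_le_1[of d] by (intro mult_mono) (auto simp: divide_right_mono)
          also have "\<dots> = 4 / real x" using d by simp
          finally show "f d / sqrt (real d) * e d \<le> 4 / real x" .
        qed
        also have "\<dots> = 4" using that by simp
        finally show "(\<Sum>d\<in>{1..x}. f d / sqrt (real d) * e d) \<le> 4" .
      qed
      finally show ?thesis .
    qed
    show ?thesis using main part1 part2 by simp
  qed
  define K where "K = 4 * real M + \<bar>c\<bar> * M + 4"
  obtain x :: nat where x: "real x > exp K" using reals_Archimedean2 by blast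
  have "x > 0" using x exp_gt_zero[of K] by (cases x) auto
  have "K < ln (real x)" using x \<open>x > 0\<close> ln_less_cancel_iff[of "exp K" "real x"] by simp
  also have "\<dots> \<le> ln (real x + 1)" using \<open>x > 0\<close> by simp
  also have "\<dots> \<le> harm x" by (rule ln_le_harm)
  also have "\<dots> \<le> K" using upper[OF \<open>x > 0\<close>] by (simp add: K_def)
  finally show False by simp
qed

end

section \<open>Chebyshev and Mertens estimates\<close>

lemma sum_ln_eq_mangoldt:
  "ln (fact x :: real) = (\<Sum>d\<in>{1..x}. mangoldt d * real (x div d))"
proof -
  have "ln (fact x :: real) = (\<Sum>n\<in>{1..x}. ln (real n))"
    by (induction x) (simp_all add: ln_mult add.commute)
  also have "\<dots> = (\<Sum>n\<in>{1..x}. \<Sum>d | d dvd n. mangoldt d)"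
    by (intro sum.cong) (auto simp: mangoldt_sum)
  also have "\<dots> = (\<Sum>d\<in>{1..x}. mangoldt d * real (x div d))"
    by (subst sum_divisors_swap) (simp add: mult.commute)
  finally show ?thesis .
qed

text \<open>Chebyshev's argument: the increment of \<open>psi\<close> from \<open>m\<close> to
  \<open>2 * m\<close> is at most the logarithm of the central binomial coefficient, hence at most
  \<open>m * ln 4\<close>. In the induction by halving, the constant 4 absorbs the rounding once
  \<open>x >= 3\<close>.\<close>

lemma sum_mangoldt_le: "(\<Sum>n\<in>{1..x}. mangoldt n) \<le> 4 * real x"
proof -
  define psi :: "nat \<Rightarrow> real" where "psi x = (\<Sum>n\<in>{1..x}. mangoldt n)" for x
  have dbl: "psi (2 * m) \<le> psi m + m * ln 4" for m
  proof -
    have "psi (2 * m) - psi m = (\<Sum>d\<in>{m<..2*m}. mangoldt d)"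
    proof -
      have split: "{1..2*m} = {1..m} \<union> {m<..2*m}" by auto
      have "psi (2 * m) = psi m + (\<Sum>d\<in>{m<..2*m}. mangoldt d)"
        unfolding psi_def split by (rule sum.union_disjoint) auto
      then show ?thesis by simp
    qed
    \<comment> \<open>The bracket is 1 on this range and nonnegative everywhere; summed over all
      \<open>d\<close> it produces \<open>ln (2 * m choose m)\<close>.\<close>
    also have "\<dots> \<le> (\<Sum>d\<in>{m<..2*m}. mangoldt d * (real (2 * m div d) - 2 * real (m div d)))"
    proof (rule sum_mono)
      fix d assume d: "d \<in> {m<..2*m}"
      then have "2 * m div d = 1" "m div d = 0" by (auto intro: div_nat_eqI)
      then show "mangoldt d \<le> mangoldt d * (real (2 * m div d) - 2 * real (m div d))" by simp
    qed
    also have "\<dots> \<le> (\<Sum>d\<in>{1..2*m}. mangoldt d * (real (2 * m div d) - 2 * real (m div d)))"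
    proof (rule sum_mono2)
      fix d assume "d \<in> {1..2*m} - {m<..2*m}"
      have "2 * (m div d) \<le> 2 * m div d"
        by (cases "d = 0") (simp_all add: less_eq_div_iff_mult_less_eq mult.assoc)
      then have "2 * real (m div d) \<le> real (2 * m div d)" by linarith
      then show "0 \<le> mangoldt d * (real (2 * m div d) - 2 * real (m div d))"
        by (simp add: mangoldt_nonneg)
    qed auto
    also have "\<dots> = ln (fact (2 * m)) - 2 * (\<Sum>d\<in>{1..2*m}. mangoldt d * real (m div d))"
      by (simp add: sum_ln_eq_mangoldt sum_subtractf sum_distrib_left algebra_simps)
    also have "(\<Sum>d\<in>{1..2*m}. mangoldt d * real (m div d)) = ln (fact m :: real)"
      unfolding sum_ln_eq_mangoldt by (rule sum.mono_neutral_right) auto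
    also have "ln (fact (2 * m)) - 2 * ln (fact m :: real) = ln (real (2 * m choose m))"
      by (simp add: binomial_fact ln_div ln_mult)
    also have "\<dots> \<le> ln (real (2 ^ (2 * m)))"
    proof (subst ln_le_cancel_iff)
      show "real (2 * m choose m) \<le> real (2 ^ (2 * m))"
        using binomial_le_pow2 by (simp only: of_nat_le_iff)
    qed auto
    also have "\<dots> = m * ln 4"
      by (simp add: power_mult ln_realpow)
    finally show ?thesis by simp
  qed
  have mono: "psi x \<le> psi y" if "x \<le> y" for x y
    unfolding psi_def using that by (intro sum_mono2) (auto simp: mangoldt_nonneg)
  have ln4: "ln (4::real) \<le> 3 / 2"
  proof -
    have "ln (4::real) = 2 * ln 2" using ln_realpow[of 2 2] by simp
    then show ?thesis using ln2_le_25_over_36 by simp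
  qed
  have "psi x \<le> 4 * real x"
  proof (induction x rule: less_induct)
    case (less x)
    consider "x = 0" | "x = 1" | "x = 2" | "x \<ge> 3" by linarith
    then show ?case
    proof cases
      case 4
      define m where "m = (x + 1) div 2"
      have m: "m < x" "x \<le> 2 * m" "2 * m \<le> x + 1" using 4 by (auto simp: m_def)
      have "psi x \<le> psi (2 * m)" using mono m by blast
      also have "\<dots> \<le> psi m + m * ln 4" by (rule dbl)
      also have "\<dots> \<le> 4 * real m + m * (3 / 2)"
        using less.IH[OF m(1)] ln4 by (intro add_mono mult_left_mono) auto
      also have "\<dots> \<le> 4 * real x" using m 4 by linarith
      finally show ?thesis .
    next
      case 3
      have "{1..2::nat} = {1, 2}" by auto
      then have "psi 2 = ln 2"
        using mangoldt_prime[of 2, where 'a = real] by (simp add: psi_def)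
      then show ?thesis using 3 ln2_le_25_over_36 by simp
    qed (auto simp: psi_def)
  qed
  then show ?thesis by (simp add: psi_def)
qed

lemma ln_Suc_minus_ln: "n > 0 \<Longrightarrow> real n * (ln (real (Suc n)) - ln (real n)) \<le> 1"
proof -
  assume "n > 0"
  then have eq: "1 + 1 / real n = real (Suc n) / real n" by (simp add: field_simps)
  have "ln (real (Suc n)) - ln (real n) = ln (1 + 1 / real n)"
    unfolding eq using \<open>n > 0\<close> by (subst ln_div) auto
  also have "\<dots> \<le> 1 / real n" by (rule ln_add_one_self_le_self) simp
  finally show ?thesis using \<open>n > 0\<close> by (simp add: field_simps)
qed

text \<open>Stirling's lower bound \<open>x * ln x - x\<close> for \<open>ln (fact x)\<close> is
  compared with its von Mangoldt expansion after removing the floors.\<close>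

lemma sum_mangoldt_over_ge:
  assumes "x > 0"
  shows "(\<Sum>n\<in>{1..x}. mangoldt n / real n) \<ge> ln (real x) - 1"
proof -
  have "ln (fact n :: real) \<ge> real n * ln (real n) - real n" for n
  proof (induction n)
    case (Suc n)
    have "real (Suc n) * ln (real (Suc n)) - real (Suc n) \<le> real n * ln (real n) - real n + ln (real (Suc n))"
    proof (cases "n = 0")
      case False
      then show ?thesis using ln_Suc_minus_ln[of n] by (simp add: algebra_simps)
    qed simp
    then show ?case using Suc by (simp add: ln_mult)
  qed simp
  then have "real x * (ln (real x) - 1) \<le> ln (fact x :: real)" by (simp add: algebra_simps)
  also have "\<dots> \<le> (\<Sum>d\<in>{1..x}. mangoldt d * (real x / real d))"
    unfolding sum_ln_eq_mangoldt
    by (intro sum_mono mult_left_mono of_nat_div_le_of_nat mangoldt_nonneg)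
  also have "\<dots> = real x * (\<Sum>d\<in>{1..x}. mangoldt d / real d)"
    by (simp add: sum_distrib_left mult.commute)
  finally show ?thesis using assms by simp
qed

context real_character
begin

text \<open>Mertens' device: in the sum \<open>R x\<close> of \<open>f n * ln n / n\<close>, write
  \<open>ln\<close> as a divisor sum of \<open>mangoldt\<close>. This turns \<open>R x\<close> into
  \<open>L * S x\<close> plus an error in which the tail of \<open>L\<close> at
  \<open>x div d\<close> is at most \<open>M * d / x\<close>; Chebyshev's bound makes the error
  bounded. \<open>R x\<close> is bounded by Abel's inequality, and \<open>L\<close> is
  nonzero.\<close>

lemma sum_mangoldt_bounded:
  obtains C where "\<And>x. \<bar>\<Sum>n\<in>{1..x}. f n * mangoldt n / real n\<bar> \<le> C"
proof -
  define S where "S x = (\<Sum>n\<in>{1..x}. f n * mangoldt n / real n)" for x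
  define R where "R x = (\<Sum>n\<in>{1..x}. f n * (ln (real n) / real n))" for x
  have R: "\<bar>R x\<bar> \<le> 2 + M" for x
  \<comment> \<open>\<open>ln n / n\<close> decreases only from \<open>n = 3\<close> on, so the
    terms at 1 and 2 are split off.\<close>
  proof (cases "x \<ge> 3")
    case True
    have ln_ge_1: "ln (real n) \<ge> 1" if "n \<ge> 3" for n
      using exp_le that by (subst ln_ge_iff) auto
    have "\<bar>\<Sum>n\<in>{3..<Suc x}. f n * (ln (real n) / real n)\<bar> \<le> M * (ln (real 3) / real 3)"
    proof (rule weighted_sum_bound)
      fix n :: nat assume n: "n \<ge> 3"
      then have "real n * ln (real (Suc n)) \<le> real (Suc n) * ln (real n)"
        using ln_Suc_minus_ln[of n] ln_ge_1[of n] by (simp add: algebra_simps)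
      then show "ln (real (Suc n)) / real (Suc n) \<le> ln (real n) / real n"
        using n by (simp add: field_simps)
    qed simp
    also have "\<dots> \<le> real M * 1"
      using ln_le_minus_one[of 3] by (intro mult_left_mono) auto
    finally have 1: "\<bar>\<Sum>n\<in>{3..<Suc x}. f n * (ln (real n) / real n)\<bar> \<le> M" by simp
    have "{1..x} = {1,2} \<union> {3..<Suc x}" using True by auto
    then have "R x = (\<Sum>n\<in>{1,2} \<union> {3..<Suc x}. f n * (ln (real n) / real n))" by (simp only: R_def)
    also have "\<dots> = f 2 * (ln 2 / 2) + (\<Sum>n\<in>{3..<Suc x}. f n * (ln (real n) / real n))"
      by (subst sum.union_disjoint) auto
    finally have "R x = f 2 * (ln 2 / 2) + (\<Sum>n\<in>{3..<Suc x}. f n * (ln (real n) / real n))" .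
    moreover have "\<bar>f 2 * (ln 2 / 2)\<bar> \<le> 1 * 1"
      unfolding abs_mult using abs_le_1[of 2] ln2_le_25_over_36 by (intro mult_mono) auto
    ultimately show ?thesis using 1 by linarith
  next
    case False
    have "\<bar>f n * (ln (real n) / real n)\<bar> \<le> 1" if "n \<ge> 1" for n
    proof -
      have "\<bar>f n * (ln (real n) / real n)\<bar> \<le> 1 * 1"
        unfolding abs_mult using abs_le_1[of n] ln_le_minus_one[of "real n"] that
        by (intro mult_mono) (auto simp: field_simps)
      then show ?thesis by simp
    qed
    then have "\<bar>R x\<bar> \<le> (\<Sum>n\<in>{1..x}. 1)"
      unfolding R_def by (intro order.trans[OF sum_abs] sum_mono) auto
    then show ?thesis using False by simp
  qed
  have "\<bar>L * S x\<bar> \<le> 2 + M + 4 * M" if "x > 0" for x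
  proof -
    define e where "e k = L - (\<Sum>m\<in>{1..k}. f m / real m)" for k
    have "R x = (\<Sum>n\<in>{1..x}. \<Sum>d | d dvd n. (f d * mangoldt d / real d) * (f (n div d) / real (n div d)))"
      unfolding R_def
    proof (rule sum.cong[OF refl])
      fix n assume n: "n \<in> {1..x}"
      then have "f n * (ln (real n) / real n) = f n / real n * (\<Sum>d | d dvd n. mangoldt d)"
        using mangoldt_sum[of n, where 'a = real] by simp
      also have "\<dots> = (\<Sum>d | d dvd n. f n / real n * mangoldt d)"
        by (rule sum_distrib_left)
      also have "\<dots> = (\<Sum>d | d dvd n. (f d * mangoldt d / real d) * (f (n div d) / real (n div d)))"
      proof (rule sum.cong[OF refl])
        fix d assume "d \<in> {d. d dvd n}"
        then obtain m where m: "n = d * m" by auto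
        then have "d > 0" using n by (auto intro: Nat.gr0I)
        then show "f n / real n * mangoldt d = (f d * mangoldt d / real d) * (f (n div d) / real (n div d))"
          by (simp add: m mult)
      qed
      finally show "f n * (ln (real n) / real n) = (\<Sum>d | d dvd n. (f d * mangoldt d / real d) * (f (n div d) / real (n div d)))" .
    qed
    also have "\<dots> = (\<Sum>d\<in>{1..x}. (f d * mangoldt d / real d) * (\<Sum>m\<in>{1..x div d}. f m / real m))"
      by (subst sum_divisors_swap) (simp add: sum_distrib_left)
    also have "\<dots> = L * S x - (\<Sum>d\<in>{1..x}. (f d * mangoldt d / real d) * e (x div d))"
      by (simp add: S_def e_def right_diff_distrib sum_subtractf sum_distrib_left algebra_simps)
    finally have "L * S x = R x + (\<Sum>d\<in>{1..x}. (f d * mangoldt d / real d) * e (x div d))" by simp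
    moreover have "\<bar>\<Sum>d\<in>{1..x}. (f d * mangoldt d / real d) * e (x div d)\<bar> \<le> 4 * M"
    proof -
      have "\<bar>(f d * mangoldt d / real d) * e (x div d)\<bar> \<le> mangoldt d * (M / x)" if d: "d \<in> {1..x}" for d
      proof -
        have "real x / real d \<le> real (Suc (x div d))"
        proof -
          have "\<lfloor>real x / real d\<rfloor> = int (x div d)" by (simp add: floor_divide_of_nat_eq)
          then show ?thesis by linarith
        qed
        moreover have "real x / real d > 0" using d by auto
        ultimately have "M / real (Suc (x div d)) \<le> M / (real x / real d)"
          by (intro divide_left_mono mult_pos_pos) auto
        then have "\<bar>e (x div d)\<bar> \<le> M * d / x"
          using L_approx[of "x div d"] by (simp add: e_def)
        moreover have "\<bar>f d * mangoldt d / real d\<bar> \<le> mangoldt d / d"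
          using abs_le_1[of d] mult_right_mono[of "\<bar>f d\<bar>" 1 "mangoldt d"]
          by (simp add: abs_mult mangoldt_nonneg divide_right_mono)
        ultimately have "\<bar>(f d * mangoldt d / real d) * e (x div d)\<bar> \<le> (mangoldt d / d) * (M * d / x)"
          unfolding abs_mult[of _ "e (x div d)"] by (intro mult_mono) (auto simp: mangoldt_nonneg)
        also have "\<dots> = mangoldt d * (M / x)" using d by simp
        finally show ?thesis .
      qed
      then have "\<bar>\<Sum>d\<in>{1..x}. (f d * mangoldt d / real d) * e (x div d)\<bar> \<le> (\<Sum>d\<in>{1..x}. mangoldt d * (M / x))"
        by (intro order.trans[OF sum_abs] sum_mono)
      also have "\<dots> = (\<Sum>d\<in>{1..x}. mangoldt d) * (M / x)" by (rule sum_distrib_right[symmetric])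
      also have "\<dots> \<le> 4 * real x * (M / x)" by (intro mult_right_mono sum_mangoldt_le) auto
      also have "\<dots> = 4 * M" using that by simp
      finally show ?thesis .
    qed
    ultimately show ?thesis using R[of x] by linarith
  qed
  then have "\<bar>S x\<bar> \<le> (2 + M + 4 * M) / \<bar>L\<bar>" for x
    using L_nonzero by (cases "x = 0") (auto simp: S_def abs_mult field_simps)
  then show thesis unfolding S_def using that by blast
qed

end

subsection \<open>Primes with prescribed quadratic characters\<close>

lemma geometric_tail_le:
  fixes r :: real
  assumes "0 \<le> r" "r \<le> 1 / 2"
  shows "(\<Sum>k\<in>{2..x}. r ^ k) \<le> 2 * r ^ 2"
proof (cases "x \<ge> 1")
  case True
  then have "(\<Sum>k\<in>{2..x}. r ^ k) + 2 * r ^ Suc x \<le> 2 * r ^ 2"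
  proof (induction x rule: dec_induct)
    case (step x)
    have "r ^ Suc x * (2 * r) \<le> r ^ Suc x * 1"
      using assms by (intro mult_left_mono) auto
    then show ?case using step by (auto simp: algebra_simps)
  qed (simp add: power2_eq_square)
  moreover have "2 * r ^ Suc x \<ge> 0" using assms by simp
  ultimately show ?thesis by linarith
next
  case False
  then show ?thesis using assms by simp
qed

text \<open>Exponents from 2 on contribute at most \<open>2 * ln q / q^2\<close> for a prime
  \<open>q\<close>; with \<open>ln q <= 2 * sqrt q\<close> this is dominated by a convergent
  series.\<close>

lemma sum_mangoldt_nonprime_bounded:
  obtains K where "\<And>x. (\<Sum>n | n \<in> {1..x} \<and> \<not> prime n. mangoldt n / real n) \<le> K"
proof -
  have summable: "summable (\<lambda>q. 4 * real q powr (-3/2))"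
    by (intro summable_mult) (simp add: summable_real_powr_iff)
  define K where "K = (\<Sum>q. 4 * real q powr (-3/2))"
  have "(\<Sum>n | n \<in> {1..x} \<and> \<not> prime n. mangoldt n / real n) \<le> K" for x :: nat
  proof -
    define J where "J = {q \<in> {2..x}. prime q} \<times> {2..x}"
    have sub: "n \<in> (\<lambda>(q,k). q ^ k) ` J" if n: "n \<in> {1..x}" "\<not> prime n" "mangoldt n \<noteq> (0::real)" for n
    proof -
      have "primepow n" using n by (auto simp: mangoldt_def split: if_splits)
      then obtain q k where qk: "prime q" "k > 0" "n = q ^ k" by (auto simp: primepow_def)
      have "k \<noteq> 1" using n qk by auto
      have "q \<ge> 2" using qk prime_ge_2_nat by blast
      have "k < 2 ^ k" by simp
      also have "\<dots> \<le> q ^ k" using \<open>q \<ge> 2\<close> by (rule power_mono) simp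
      finally have "k \<le> x" using n qk by simp
      have "q ^ 1 \<le> q ^ k" using \<open>q \<ge> 2\<close> qk by (intro power_increasing) auto
      then have "q \<le> x" using n qk by simp
      show ?thesis using qk \<open>k \<noteq> 1\<close> \<open>q \<ge> 2\<close> \<open>k \<le> x\<close> \<open>q \<le> x\<close>
        by (intro image_eqI[of _ _ "(q,k)"]) (auto simp: J_def)
    qed
    have "finite J" by (auto simp: J_def)
    have "(\<Sum>n | n \<in> {1..x} \<and> \<not> prime n. mangoldt n / real n) \<le>
        (\<Sum>n\<in>(\<lambda>(q,k). q ^ k) ` J. mangoldt n / real n)"
    proof -
      have "(\<Sum>n | n \<in> {1..x} \<and> \<not> prime n. mangoldt n / real n) =
          (\<Sum>n | n \<in> {1..x} \<and> \<not> prime n \<and> mangoldt n \<noteq> (0::real). mangoldt n / real n)"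
        by (rule sum.mono_neutral_right) auto
      also have "\<dots> \<le> (\<Sum>n\<in>(\<lambda>(q,k). q ^ k) ` J. mangoldt n / real n)"
        using sub \<open>finite J\<close> by (intro sum_mono2) (auto simp: mangoldt_nonneg)
      finally show ?thesis .
    qed
    also have "\<dots> \<le> (\<Sum>p\<in>J. mangoldt (fst p ^ snd p) / real (fst p ^ snd p))"
      using sum_image_le[of J "\<lambda>n. mangoldt n / real n" "\<lambda>(q,k). q ^ k"] \<open>finite J\<close>
      by (simp add: mangoldt_nonneg o_def case_prod_unfold)
    also have "\<dots> = (\<Sum>q | q \<in> {2..x} \<and> prime q. \<Sum>k\<in>{2..x}. mangoldt (q ^ k) / real (q ^ k))"
      by (simp add: J_def sum.cartesian_product case_prod_unfold del: mangoldt_primepow')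
    also have "\<dots> \<le> (\<Sum>q | q \<in> {2..x} \<and> prime q. 4 * real q powr (-3/2))"
    proof (rule sum_mono)
      fix q assume q: "q \<in> {q. q \<in> {2..x} \<and> prime q}"
      then have q2: "real q \<ge> 2" by simp
      have "(\<Sum>k\<in>{2..x}. mangoldt (q ^ k) / real (q ^ k)) = (\<Sum>k\<in>{2..x}. ln q * (1 / real q) ^ k)"
        using q by (intro sum.cong) (auto simp: power_divide)
      also have "\<dots> = ln q * (\<Sum>k\<in>{2..x}. (1 / real q) ^ k)" by (rule sum_distrib_left[symmetric])
      also have "\<dots> \<le> ln q * (2 * (1 / real q) ^ 2)"
        using q2 by (intro mult_left_mono geometric_tail_le) auto
      also have "\<dots> \<le> (2 * sqrt q) * (2 * (1 / real q) ^ 2)"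
      proof (rule mult_right_mono)
        have "ln (real q) = 2 * ln (sqrt q)" using q2 by (simp add: ln_sqrt)
        also have "\<dots> \<le> 2 * sqrt q" using ln_le_minus_one[of "sqrt q"] q2 by simp
        finally show "ln (real q) \<le> 2 * sqrt q" .
      qed simp
      also have "\<dots> = 4 * real q powr (-3/2)"
      proof -
        have "real q powr (-3/2) = real q powr (1/2) * real q powr (-2)"
          by (simp flip: powr_add)
        also have "\<dots> = sqrt q * (1 / real q) ^ 2"
          using q2 powr_neg_numeral[of "real q" "Num.Bit0 Num.One"] by (simp only: powr_half_sqrt power_divide) simp
        finally show ?thesis by simp
      qed
      finally show "(\<Sum>k\<in>{2..x}. mangoldt (q ^ k) / real (q ^ k)) \<le> 4 * real q powr (-3/2)" .
    qed
    also have "\<dots> \<le> K"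
      unfolding K_def using summable by (intro sum_le_suminf) auto
    finally show ?thesis .
  qed
  then show thesis by (rule that)
qed

text \<open>The weight \<open>W\<close>, a product of factors
  \<open>1 + \<epsilon> i * g i n\<close>, vanishes unless all signs are as prescribed. Expanded, it
  is a signed sum of the characters \<open>ch T\<close>. For nonempty \<open>T\<close> they are
  nonprincipal by \<open>indep\<close>, with bounded Mertens sums, while the principal one
  contributes \<open>ln x\<close>. Without a suitable prime above \<open>B\<close>, only higher
  prime powers and finitely many primes would carry weight, and the sum would be bounded.\<close>

lemma ex_prime_characters:
  fixes g :: "'i \<Rightarrow> nat \<Rightarrow> real" and \<epsilon> :: "'i \<Rightarrow> real"
  assumes "finite I" and M: "M > 0"
    and mult: "\<And>i m n. i \<in> I \<Longrightarrow> g i (m * n) = g i m * g i n"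
    and periodic: "\<And>i n. i \<in> I \<Longrightarrow> g i (n + M) = g i n"
    and range: "\<And>i n. i \<in> I \<Longrightarrow> coprime n M \<Longrightarrow> g i n \<in> {-1, 1}"
    and indep: "\<And>i. i \<in> I \<Longrightarrow> \<exists>n. coprime n M \<and> g i n = -1 \<and> (\<forall>j\<in>I-{i}. g j n = 1)"
    and eps: "\<And>i. i \<in> I \<Longrightarrow> \<epsilon> i \<in> {-1, 1}"
  shows "\<exists>q. prime q \<and> q > B \<and> (\<forall>i\<in>I. g i q = \<epsilon> i)"
proof (rule ccontr)
  assume no_prime: "\<not> ?thesis"
  \<comment> \<open>The signs of \<open>g i\<close> are known only on residues coprime to
    \<open>M\<close>; elsewhere the product is cut off to 0, as a character requires.\<close>
  define ch where "ch T n = (if coprime n M then \<Prod>i\<in>T. g i n else 0)" for T n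
  define S where "S T x = (\<Sum>n\<in>{1..x}. ch T n * mangoldt n / real n)" for T x
  have char: "real_character (ch T) M" if T: "T \<subseteq> I" "T \<noteq> {}" for T
  proof
    fix m n
    show "ch T (m * n) = ch T m * ch T n"
      using T mult by (auto simp: ch_def prod.distrib[symmetric] intro!: prod.cong)
    show "ch T (n + M) = ch T n"
    proof -
      have "coprime (n + M) M = coprime n M" by (simp only: coprime_iff_gcd_eq_1 gcd_add1)
      then show ?thesis using T periodic by (auto simp: ch_def intro!: prod.cong)
    qed
    show "ch T n \<in> {-1, 0, 1}"
    proof (cases "coprime n M")
      case True
      have "finite T" using T(1) \<open>finite I\<close> by (rule finite_subset)
      then have "(\<Prod>i\<in>T. g i n) \<in> {-1, 1}" using T(1) range[OF _ True]
        by (induction T rule: finite_induct) fastforce+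
      then show ?thesis by (auto simp: ch_def)
    qed (simp add: ch_def)
    have "g i 1 = 1" if "i \<in> I" for i using mult[OF that, of 1 1] range[OF that, of 1] by auto
    then show "ch T 1 = 1" using T by (auto simp: ch_def intro!: prod.neutral)
    show "ch T n = 0" if "\<not> coprime n M" using that by (simp add: ch_def)
    \<comment> \<open>Where \<open>g i\<close> alone is -1, so is the product over any
      \<open>T\<close> containing \<open>i\<close>.\<close>
    obtain i where i: "i \<in> T" using T by blast
    then obtain k where k: "coprime k M" "g i k = -1" "\<forall>j\<in>I-{i}. g j k = 1"
      using indep[of i] T by blast
    have "(\<Prod>j\<in>T. g j k) = g i k * (\<Prod>j\<in>T-{i}. g j k)"
      using i T \<open>finite I\<close> by (intro prod.remove) (auto intro: finite_subset)
    also have "(\<Prod>j\<in>T-{i}. g j k) = 1"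
      using k T by (intro prod.neutral) auto
    finally show "\<exists>n. ch T n = -1" using k by (auto simp: ch_def intro!: exI[of _ k])
  qed (rule M)
  have "\<exists>C. \<forall>x. \<bar>S T x\<bar> \<le> C" if "T \<subseteq> I" "T \<noteq> {}" for T
    using real_character.sum_mangoldt_bounded[OF char[OF that]] unfolding S_def by metis
  then obtain C where C: "\<And>T x. T \<subseteq> I \<Longrightarrow> T \<noteq> {} \<Longrightarrow> \<bar>S T x\<bar> \<le> C T" by metis
  obtain K where K: "\<And>x. (\<Sum>n | n \<in> {1..x} \<and> \<not> prime n. mangoldt n / real n) \<le> K"
    using sum_mangoldt_nonprime_bounded by blast
  \<comment> \<open>Primes above \<open>M\<close> are automatically coprime to
    \<open>M\<close>.\<close>
  define B' where "B' = max B M"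
  define K' where "K' = K + (\<Sum>n\<in>{1..B'}. mangoldt n / real n)"
  have K': "(\<Sum>n | n \<in> {1..x} \<and> \<not> (prime n \<and> n > B'). mangoldt n / real n) \<le> K'" for x
  proof -
    have "(\<Sum>n | n \<in> {1..x} \<and> \<not> (prime n \<and> n > B'). mangoldt n / real n)
        \<le> (\<Sum>n \<in> {n. n \<in> {1..x} \<and> \<not> prime n} \<union> {1..B'}. mangoldt n / real n)"
      by (intro sum_mono2) (auto simp: mangoldt_nonneg)
    also have "\<dots> \<le> (\<Sum>n | n \<in> {1..x} \<and> \<not> prime n. mangoldt n / real n) + (\<Sum>n\<in>{1..B'}. mangoldt n / real n)"
      by (subst sum_Un) (auto intro!: sum_nonneg simp: mangoldt_nonneg)
    finally show ?thesis using K[of x] by (simp add: K'_def)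
  qed
  define W where "W n = (if coprime n M then \<Prod>i\<in>I. (\<epsilon> i * g i n + 1) else 0)" for n
  have W_range: "0 \<le> W n \<and> W n \<le> 2 ^ card I" for n
  proof (cases "coprime n M")
    case True
    have factor: "0 \<le> \<epsilon> i * g i n + 1 \<and> \<epsilon> i * g i n + 1 \<le> 2" if "i \<in> I" for i
      using eps[OF that] range[OF that True] by auto
    then have "(\<Prod>i\<in>I. (\<epsilon> i * g i n + 1)) \<le> (\<Prod>i\<in>I. 2)" by (intro prod_mono) auto
    then show ?thesis using True factor by (auto simp: W_def intro!: prod_nonneg)
  qed (simp add: W_def)
  have W_prime: "W n = 0" if n: "prime n" "n > B'" for n
  proof -
    obtain i where i: "i \<in> I" "g i n \<noteq> \<epsilon> i" using no_prime n by (auto simp: B'_def)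
    have "\<not> n dvd M" using n M by (auto dest!: dvd_imp_le simp: B'_def)
    then have "coprime n M" using n by (intro prime_imp_coprime)
    then have "\<epsilon> i * g i n + 1 = 0" using eps[OF i(1)] range[OF i(1), of n] i(2) by auto
    then show ?thesis using i \<open>finite I\<close> by (auto simp: W_def intro!: prod_zero bexI[of _ i])
  qed
  have upper: "(\<Sum>n\<in>{1..x}. W n * mangoldt n / real n) \<le> 2 ^ card I * K'" for x
  proof -
    have "(\<Sum>n\<in>{1..x}. W n * mangoldt n / real n) =
        (\<Sum>n | n \<in> {1..x} \<and> \<not> (prime n \<and> n > B'). W n * mangoldt n / real n)"
      using W_prime by (intro sum.mono_neutral_right) auto
    also have "\<dots> \<le> (\<Sum>n | n \<in> {1..x} \<and> \<not> (prime n \<and> n > B'). 2 ^ card I * (mangoldt n / real n))"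
      using W_range by (intro sum_mono) (auto simp: mangoldt_nonneg intro!: divide_right_mono mult_right_mono)
    also have "\<dots> = 2 ^ card I * (\<Sum>n | n \<in> {1..x} \<and> \<not> (prime n \<and> n > B'). mangoldt n / real n)"
      by (rule sum_distrib_left[symmetric])
    also have "\<dots> \<le> 2 ^ card I * K'" using K' by (intro mult_left_mono) auto
    finally show ?thesis .
  qed
  have expand: "W n = (\<Sum>T\<in>Pow I. (\<Prod>i\<in>T. \<epsilon> i) * ch T n)" for n
    by (simp add: W_def ch_def prod_add[OF \<open>finite I\<close>] prod.distrib)
  have principal: "S {} x \<ge> ln (real x) - 1 - K'" if "x > 0" for x
  proof -
    have "ln (real x) - 1 \<le> (\<Sum>n\<in>{1..x}. mangoldt n / real n)" using that by (rule sum_mangoldt_over_ge)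
    also have "\<dots> = S {} x + (\<Sum>n\<in>{1..x}. (1 - ch {} n) * mangoldt n / real n)"
      by (simp add: S_def sum.distrib[symmetric] add_divide_distrib[symmetric] algebra_simps)
    also have "(\<Sum>n\<in>{1..x}. (1 - ch {} n) * mangoldt n / real n) =
        (\<Sum>n | n \<in> {1..x} \<and> \<not> (prime n \<and> n > B'). (1 - ch {} n) * mangoldt n / real n)"
    proof (rule sum.mono_neutral_right)
      have "ch {} n = 1" if n: "prime n" "n > B'" for n
      proof -
        have "\<not> n dvd M" using n M by (auto dest!: dvd_imp_le simp: B'_def)
        then show ?thesis using n by (auto simp: ch_def intro!: prime_imp_coprime)
      qed
      then show "\<forall>n\<in>{1..x} - {n. n \<in> {1..x} \<and> \<not> (prime n \<and> n > B')}. (1 - ch {} n) * mangoldt n / real n = 0"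
        by auto
    qed auto
    also have "\<dots> \<le> (\<Sum>n | n \<in> {1..x} \<and> \<not> (prime n \<and> n > B'). mangoldt n / real n)"
      by (intro sum_mono) (auto simp: ch_def mangoldt_nonneg)
    also have "\<dots> \<le> K'" by (rule K')
    finally show ?thesis by simp
  qed
  have lower: "(\<Sum>n\<in>{1..x}. W n * mangoldt n / real n) \<ge> ln (real x) - 1 - K' - (\<Sum>T\<in>Pow I - {{}}. C T)"
    if "x > 0" for x
  proof -
    have "(\<Sum>n\<in>{1..x}. W n * mangoldt n / real n) = (\<Sum>n\<in>{1..x}. \<Sum>T\<in>Pow I. (\<Prod>i\<in>T. \<epsilon> i) * (ch T n * mangoldt n / real n))"
      unfolding expand by (simp add: sum_distrib_right sum_divide_distrib mult.assoc)
    also have "\<dots> = (\<Sum>T\<in>Pow I. (\<Prod>i\<in>T. \<epsilon> i) * S T x)"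
      unfolding S_def sum_distrib_left by (rule sum.swap)
    also have "\<dots> = S {} x + (\<Sum>T\<in>Pow I - {{}}. (\<Prod>i\<in>T. \<epsilon> i) * S T x)"
      using \<open>finite I\<close> by (subst sum.remove[of _ "{}"]) auto
    also have "\<dots> \<ge> ln (real x) - 1 - K' + (\<Sum>T\<in>Pow I - {{}}. - C T)"
    proof (intro add_mono principal that sum_mono)
      fix T assume T: "T \<in> Pow I - {{}}"
      have "\<bar>\<Prod>i\<in>T. \<epsilon> i\<bar> = 1"
        unfolding abs_prod using T eps by (intro prod.neutral) fastforce
      then have "\<bar>(\<Prod>i\<in>T. \<epsilon> i) * S T x\<bar> \<le> C T" using C[of T x] T by (simp add: abs_mult)
      then show "- C T \<le> (\<Prod>i\<in>T. \<epsilon> i) * S T x" by linarith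
    qed
    finally show ?thesis by (simp add: sum_negf)
  qed
  define Z where "Z = 2 ^ card I * K' + 1 + K' + (\<Sum>T\<in>Pow I - {{}}. C T)"
  have le: "ln (real x) \<le> Z" if "x > 0" for x :: nat
    using lower[OF that] upper[of x] unfolding Z_def by linarith
  obtain x :: nat where x: "real x > exp Z" using reals_Archimedean2 by blast
  have "real x > 0" using x exp_gt_zero[of Z] by linarith
  then have "Z < ln (real x)" using x ln_less_cancel_iff[of "exp Z" "real x"] by simp
  with le[of x] \<open>real x > 0\<close> show False by simp
qed

section \<open>Legendre symbols and the supplementary characters\<close>

lemma Legendre_cong: "[a = b] (mod p) \<Longrightarrow> Legendre a p = Legendre b p"
  by (simp add: Legendre_def QuadRes_def Cong.cong_def)

text \<open>Euler's criterion makes both sides congruent modulo \<open>p\<close>, and they differ by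
  at most 2, which is less than \<open>p\<close>.\<close>

lemma Legendre_mult:
  assumes "prime p" "2 < p"
  shows "Legendre (a * b) (int p) = Legendre a p * Legendre b p"
proof -
  let ?k = "(p - 1) div 2"
  have "[Legendre (a * b) p = (a * b) ^ ?k] (mod p)"
    using assms by (rule euler_criterion)
  moreover have "[Legendre a p * Legendre b p = a ^ ?k * b ^ ?k] (mod p)"
    using assms by (intro cong_mult euler_criterion)
  ultimately have "[Legendre (a * b) p = Legendre a p * Legendre b p] (mod p)"
    by (metis cong_sym cong_trans power_mult_distrib)
  then have dvd: "int p dvd Legendre (a * b) p - Legendre a p * Legendre b p"
    by (simp add: cong_iff_dvd_diff)
  have "\<bar>Legendre (a * b) p - Legendre a p * Legendre b p\<bar> \<le> 2"
    by (auto simp: Legendre_def)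
  then have "Legendre (a * b) p - Legendre a p * Legendre b p = 0"
    using dvd \<open>2 < p\<close> dvd_imp_le_int[OF _ dvd] by linarith
  then show ?thesis by simp
qed

lemma Legendre_square: "\<not> p dvd a \<Longrightarrow> Legendre (a\<^sup>2) p = 1" if "prime p" for p a :: int
  using that by (auto simp: Legendre_def QuadRes_def cong_0_iff prime_dvd_power_iff intro!: exI[of _ a])

lemma Legendre_eq_1D:
  assumes "Legendre a p = 1"
  obtains y where "p dvd y\<^sup>2 - a"
  using assms by (auto simp: Legendre_def QuadRes_def cong_iff_dvd_diff split: if_splits)

text \<open>Squaring identifies 1 and \<open>p - 1\<close>, so on the finite set of nonzero residues
  it is not injective and hence not surjective.\<close>

lemma ex_nonresidue:
  assumes "prime p" "2 < p"
  obtains a :: nat where "Legendre (int a) (int p) = -1"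
proof -
  define s where "s y = y\<^sup>2 mod p" for y
  have "s ` {1..<p} \<subseteq> {1..<p}"
    using assms by (auto simp: s_def prime_dvd_power_iff mod_greater_zero_iff_not_dvd Suc_le_eq dest: nat_dvd_not_less)
  moreover have "\<not> inj_on s {1..<p}"
  proof
    assume inj: "inj_on s {1..<p}"
    have "(p - 1)\<^sup>2 = 1 + (p - 2) * p"
      using assms(2) by (cases p) (auto simp: power2_eq_square algebra_simps numeral_2_eq_2 Suc_diff_le)
    then have "s (p - 1) = s 1" by (simp only: s_def mod_mult_self1 power_one)
    then have "p - 1 = 1" using inj_onD[OF inj, of "p - 1" 1] assms by simp
    then show False using assms by linarith
  qed
  ultimately have "s ` {1..<p} \<noteq> {1..<p}"
    using eq_card_imp_inj_on[of "{1..<p}" s] by auto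
  with \<open>s ` {1..<p} \<subseteq> {1..<p}\<close> obtain a where a: "a \<in> {1..<p}" "a \<notin> s ` {1..<p}" by blast
  have "\<not> QuadRes p a"
  proof
    assume "QuadRes p a"
    then obtain y where y: "[y\<^sup>2 = int a] (mod int p)" by (auto simp: QuadRes_def)
    define z where "z = nat (y mod int p)"
    have z: "int z = y mod int p" using assms by (simp add: z_def)
    have "int (z\<^sup>2 mod p) = int a mod int p"
      using y by (simp add: zmod_int z Cong.cong_def power_mod)
    then have "s z = a" using a by (simp add: s_def flip: zmod_int)
    moreover have "z \<noteq> 0" using a \<open>s z = a\<close> by (intro notI) (simp add: s_def)
    moreover have "z < p" using z assms by (simp add: z_def nat_less_iff)
    ultimately show False using a by auto
  qed
  moreover have "\<not> [int a = 0] (mod int p)" using a by (auto simp: cong_0_iff dest: nat_dvd_not_less)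
  ultimately have "Legendre (int a) (int p) = -1" by (simp add: Legendre_def)
  then show thesis by (rule that)
qed

text \<open>The indices 0 and 1, which are not prime, stand for the characters \<open>(-1/n)\<close> and \<open>(2/n)\<close>.\<close>

definition quadratic_character :: "nat \<Rightarrow> nat \<Rightarrow> int" where
  "quadratic_character i n =
     (if i = 0 then if even n then 0 else if n mod 8 \<in> {1, 5} then 1 else -1
      else if i = 1 then if even n then 0 else if n mod 8 \<in> {1, 7} then 1 else -1
      else Legendre (int n) (int i))"

lemma quadratic_character_0:
  "quadratic_character 0 n = (if even n then 0 else if n mod 8 \<in> {1, 5} then 1 else -1)"
  by (simp add: quadratic_character_def)

lemma quadratic_character_1:
  "quadratic_character 1 n = (if even n then 0 else if n mod 8 \<in> {1, 7} then 1 else -1)"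
  by (simp add: quadratic_character_def)

lemma odd_mod_8: "odd k \<Longrightarrow> k mod 8 \<in> {1, 3, 5, 7}" for k :: nat
  by simp presburger

lemma quadratic_character_mult:
  assumes "i \<in> {0, 1} \<or> prime i \<and> 2 < i"
  shows "quadratic_character i (m * n) = quadratic_character i m * quadratic_character i n"
proof -
  have m8: "(a * b) mod 8 = ((a mod 8) * (b mod 8)) mod 8" for a b :: nat by (simp add: mod_mult_eq)
  consider "i = 0" | "i = 1" | "prime i" "2 < i" using assms by auto
  then show ?thesis
  proof cases
    case 1
    show ?thesis
    proof (cases "even m \<or> even n")
      case False
      then have o: "odd m" "odd n" by auto
      then show ?thesis using odd_mod_8[OF o(1)] odd_mod_8[OF o(2)] unfolding 1 quadratic_character_0 m8[of m n]
        by - (elim insertE emptyE conjE, simp_all)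
    qed (auto simp: 1 quadratic_character_0)
  next
    case 2
    show ?thesis
    proof (cases "even m \<or> even n")
      case False
      then have o: "odd m" "odd n" by auto
      then show ?thesis using odd_mod_8[OF o(1)] odd_mod_8[OF o(2)] unfolding 2 quadratic_character_1 m8[of m n]
        by - (elim insertE emptyE conjE, simp_all)
    qed (auto simp: 2 quadratic_character_def)
  next
    case 3
    then show ?thesis by (auto simp: quadratic_character_def Legendre_mult)
  qed
qed

text \<open>An odd residue modulo 8 is determined by the characters 0 and 1, so the congruence
  condition is itself a prescription of real characters. Their independence comes from the Chinese
  remainder theorem.\<close>

lemma ex_prime_Legendre:
  fixes \<epsilon> :: "nat \<Rightarrow> int"
  assumes "finite S" and S: "\<And>l. l \<in> S \<Longrightarrow> prime l \<and> 2 < l"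
    and eps: "\<And>l. l \<in> S \<Longrightarrow> \<epsilon> l \<in> {-1, 1}" and "odd c"
  shows "\<exists>q>B. prime q \<and> [q = c] (mod 8) \<and> (\<forall>l\<in>S. Legendre (int q) (int l) = \<epsilon> l)"
proof -
  define M where "M = 8 * \<Prod>S"
  define I where "I = {0, 1} \<union> S"
  define \<delta> where "\<delta> i = (if i \<in> S then \<epsilon> i else quadratic_character i c)" for i
  have notS: "0 \<notin> S" "1 \<notin> S" using S by force+
  have "M > 0" using S by (auto simp: M_def prime_gt_0_nat intro!: prod_pos)
  have dvdM: "l dvd M" if "l \<in> S" for l using that \<open>finite S\<close> unfolding M_def by (intro dvd_mult dvd_prodI)
  have "8 dvd M" by (simp add: M_def)
  have odd_coprime: "odd n" if "coprime n M" for n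
    using that \<open>8 dvd M\<close> by (metis coprime_common_divisor dvd_trans even_numeral nat_dvd_1_iff_1 numeral_eq_one_iff semiring_norm(83) odd_one)
  have char: "quadratic_character l n = Legendre (int n) (int l)" if "l \<in> S" for l n
    using S[OF that] by (simp add: quadratic_character_def)
  have "\<exists>q. prime q \<and> q > B \<and> (\<forall>i\<in>I. real_of_int (quadratic_character i q) = real_of_int (\<delta> i))"
  proof (rule ex_prime_characters)
    show "finite I" "M > 0" using \<open>finite S\<close> \<open>M > 0\<close> by (auto simp: I_def)
    fix i assume i: "i \<in> I"
    then have i': "i \<in> {0, 1} \<or> prime i \<and> 2 < i" using S by (auto simp: I_def)
    show "real_of_int (quadratic_character i (m * n)) =
        real_of_int (quadratic_character i m) * real_of_int (quadratic_character i n)" for m n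
      using quadratic_character_mult[OF i'] by simp
    show "real_of_int (quadratic_character i (n + M)) = real_of_int (quadratic_character i n)" for n
    proof -
      obtain k where k: "M = 8 * k" using \<open>8 dvd M\<close> by blast
      consider "i = 0" | "i = 1" | "i \<in> S" using i by (auto simp: I_def)
      then have "quadratic_character i (n + M) = quadratic_character i n"
      proof cases
        case 1
        show ?thesis unfolding 1 k quadratic_character_0 by simp
      next
        case 2
        show ?thesis unfolding 2 k quadratic_character_1 by simp
      next
        case 3
        have "[int (n + M) = int n] (mod int i)" using dvdM[OF 3] by (simp add: cong_iff_dvd_diff)
        then show ?thesis using char[OF 3] by (metis Legendre_cong)
      qed
      then show ?thesis by simp
    qed
    show "real_of_int (quadratic_character i n) \<in> {-1, 1}" if "coprime n M" for n
    proof (cases "i \<in> S")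
      case True
      have "coprime n i" using that dvdM[OF True] by (meson coprime_divisors dvd_refl)
      then have "\<not> i dvd n" using S[OF True] by (metis coprime_absorb_right not_prime_unit)
      then have "\<not> [int n = 0] (mod int i)" by (simp add: cong_0_iff)
      then show ?thesis using char[OF True] by (auto simp: Legendre_def)
    next
      case False
      then have "i = 0 \<or> i = 1" using i by (auto simp: I_def)
      then show ?thesis using odd_coprime[OF that] by (auto simp: quadratic_character_def)
    qed
    show "real_of_int (\<delta> i) \<in> {-1, 1}"
      using i eps[of i] \<open>odd c\<close> by (auto simp: \<delta>_def I_def quadratic_character_def)
    show "\<exists>n. coprime n M \<and> real_of_int (quadratic_character i n) = -1 \<and>
        (\<forall>j\<in>I - {i}. real_of_int (quadratic_character j n) = 1)"
    proof -
      define a where "a l = (SOME a. Legendre (int a) (int l) = -1)" for l :: nat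
      have a: "Legendre (int (a l)) (int l) = -1" if "l \<in> S" for l
        unfolding a_def by (rule someI_ex) (use ex_nonresidue S[OF that] in blast)
      \<comment> \<open>The key 8 is the modulus 8. There 7 has first character -1 and second 1, and
        5 the reverse, so each changes exactly one of the two. At the prime \<open>i\<close> a
        nonresidue is taken, at all other primes 1.\<close>
      define u where "u l = (if l = 8 then if i = 0 then 7 else if i = 1 then 5 else 1
        else if l = i then a i else 1)" for l :: nat
      have "8 \<notin> S" using S[of 8] by auto
      have "\<exists>x. \<forall>l\<in>insert 8 S. [x = u l] (mod l)"
      proof (rule chinese_remainder_nat)
        show "finite (insert 8 S)" using \<open>finite S\<close> by simp
        have 8: "coprime 8 l" if "l \<in> S" for l :: nat
        proof -
          have "odd l" using S[OF that] prime_odd_nat by blast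
          then have "coprime (2 ^ 3) l" by (simp only: coprime_power_left_iff coprime_left_2_iff_odd) simp
          then show ?thesis by simp
        qed
        show "\<forall>l\<in>insert 8 S. \<forall>m\<in>insert 8 S. l \<noteq> m \<longrightarrow> coprime l m"
          using 8 S by (auto simp: coprime_commute intro: primes_coprime)
      qed
      then obtain n where n8: "[n = u 8] (mod 8)" and nl: "\<And>l. l \<in> S \<Longrightarrow> [n = u l] (mod l)" by blast
      have n8: "n mod 8 = (if i = 0 then 7 else if i = 1 then 5 else 1)"
        using n8 by (simp add: u_def Cong.cong_def)
      have "odd n" using n8 by (simp split: if_splits; presburger)
      have leg: "Legendre (int n) (int l) = (if l = i then -1 else 1)" if "l \<in> S" for l
      proof -
        have "[int n = int (u l)] (mod int l)" using nl[OF that] by (simp add: cong_int_iff)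
        then have "Legendre (int n) (int l) = Legendre (int (u l)) (int l)" by (rule Legendre_cong)
        also have "\<dots> = (if l = i then -1 else 1)"
        proof (cases "l = i")
          case True
          then show ?thesis using a[OF that] that \<open>8 \<notin> S\<close> by (auto simp: u_def)
        next
          case False
          then show ?thesis using Legendre_square[of "int l" 1] S[OF that] that \<open>8 \<notin> S\<close>
            by (auto simp: u_def)
        qed
        finally show ?thesis .
      qed
      have "coprime n l" if "l \<in> S" for l
      proof -
        have "\<not> l dvd n" using leg[OF that] by (auto simp: Legendre_def cong_0_iff split: if_splits)
        then show ?thesis using S[OF that] by (metis coprime_commute prime_imp_coprime)
      qed
      then have "coprime n (\<Prod>S)" by (rule prod_coprime_right)
      moreover have "coprime n (2 ^ 3)" using \<open>odd n\<close> by (simp only: coprime_power_right_iff coprime_right_2_iff_odd) simp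
      ultimately have "coprime n M" by (simp add: M_def)
      moreover have "quadratic_character j n = (if j = i then -1 else 1)" if "j \<in> I" for j
      proof (cases "j \<in> S")
        case True
        then show ?thesis using leg char by simp
      next
        case False
        then have "j = 0 \<or> j = 1" using that by (auto simp: I_def)
        then show ?thesis using n8 \<open>odd n\<close> by (auto simp: quadratic_character_def)
      qed
      ultimately show ?thesis using i by (intro exI[of _ n]) auto
    qed
  qed
  then obtain q where q: "prime q" "q > B" "\<And>i. i \<in> I \<Longrightarrow> quadratic_character i q = \<delta> i" by auto
  have "quadratic_character 0 q = quadratic_character 0 c" "quadratic_character 1 q = quadratic_character 1 c"
    using q(3)[of 0] q(3)[of 1] notS by (auto simp: \<delta>_def I_def)
  then have eq: "(if even q then 0 else if q mod 8 \<in> {1, 5} then 1 else -1) = (if c mod 8 \<in> {1, 5} then 1 else -1 :: int)"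
      "(if even q then 0 else if q mod 8 \<in> {1, 7} then 1 else -1) = (if c mod 8 \<in> {1, 7} then 1 else -1 :: int)"
    using \<open>odd c\<close> unfolding quadratic_character_0 quadratic_character_1 by auto
  then have "odd q" by (auto split: if_splits)
  then have "q mod 8 = c mod 8"
    using eq odd_mod_8[OF \<open>odd q\<close>] odd_mod_8[OF \<open>odd c\<close>] by - (elim insertE emptyE, simp_all)
  then have "[q = c] (mod 8)" by (simp add: Cong.cong_def)
  moreover have "Legendre (int q) (int l) = \<epsilon> l" if "l \<in> S" for l
    using q(3)[of l] char[OF that] that by (simp add: I_def \<delta>_def)
  ultimately show ?thesis using q by blast
qed


lemma Legendre_minus_one:
  assumes "prime p" "2 < p"
  shows "Legendre (-1) (int p) = (if p mod 4 = 1 then 1 else -1)"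
proof -
  have "odd p" using assms prime_odd_nat by blast
  have "[Legendre (-1) (int p) = (-1) ^ ((p - 1) div 2)] (mod int p)"
    using euler_criterion[OF assms] .
  moreover have "even ((p - 1) div 2) \<longleftrightarrow> p mod 4 = 1"
    using \<open>odd p\<close> by presburger
  ultimately have "[Legendre (-1) (int p) = (if p mod 4 = 1 then 1 else -1)] (mod int p)"
    by (simp add: minus_one_power_iff split: if_splits)
  then have dvd: "int p dvd Legendre (-1) (int p) - (if p mod 4 = 1 then 1 else -1)"
    by (simp add: cong_iff_dvd_diff)
  have "\<bar>Legendre (-1) (int p) - (if p mod 4 = 1 then 1 else -1)\<bar> \<le> 2"
    by (auto simp: Legendre_def)
  then have "Legendre (-1) (int p) - (if p mod 4 = 1 then 1 else -1) = 0"
    using \<open>2 < p\<close> dvd_imp_le_int[OF _ dvd] by linarith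
  then show ?thesis by linarith
qed

text \<open>Gauss's lemma with \<open>p = 4 * k + 1\<close>: among the doubles of 1, ...,
  \<open>2 * k\<close>, those above \<open>p / 2\<close> come from \<open>k + 1\<close>, ...,
  \<open>2 * k\<close>, so there are \<open>k\<close> of them.\<close>

lemma Legendre_two:
  assumes "prime p" "p mod 4 = 1"
  shows "Legendre 2 (int p) = (if p mod 8 = 1 then 1 else -1)"
proof -
  obtain k where k: "p = 4 * k + 1" using assms(2) by (metis mult_div_mod_eq)
  have "k > 0" using assms(1) k by (auto intro: Nat.gr0I)
  interpret GAUSS p 2
  proof
    show "prime p" "2 < p" using assms(1) k \<open>k > 0\<close> by auto
    show "[2 \<noteq> 0] (mod int p)"
      using k \<open>k > 0\<close> by (auto simp: cong_0_iff dest: zdvd_imp_le)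
  qed auto
  have half: "(int p - 1) div 2 = 2 * int k" by (simp add: k)
  have "E = (\<lambda>x. 2 * x) ` {int k + 1..2 * int k}"
  proof (intro equalityI subsetI)
    fix y assume "y \<in> E"
    then obtain x where x: "x \<in> {0<..2 * int k}" "y = x * 2 mod int p" "y > 2 * int k"
      unfolding E_def C_def B_def A_def half by auto
    then have "y = x * 2" by (simp add: k mod_pos_pos_trivial)
    then show "y \<in> (\<lambda>x. 2 * x) ` {int k + 1..2 * int k}" using x by auto
  next
    fix y assume "y \<in> (\<lambda>x. 2 * x) ` {int k + 1..2 * int k}"
    then obtain x where x: "x \<in> {int k + 1..2 * int k}" "y = 2 * x" by auto
    then have "y = x * 2 mod int p" by (simp add: k mod_pos_pos_trivial)
    then show "y \<in> E" using x unfolding E_def C_def B_def A_def half by auto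
  qed
  then have "card E = k" by (simp add: card_image inj_on_def)
  then have "Legendre 2 (int p) = (-1) ^ k" using gauss_lemma by simp
  moreover have "even k \<longleftrightarrow> p mod 8 = 1" using k by presburger
  ultimately show ?thesis by (simp add: minus_one_power_iff)
qed

lemma Legendre_reciprocity:
  assumes "prime p" "2 < p" "prime q" "2 < q" "p \<noteq> q"
  shows "Legendre (int p) (int q) = (if p mod 4 = 1 \<or> q mod 4 = 1 then 1 else -1) * Legendre (int q) (int p)"
proof -
  have odd: "odd p" "odd q" using assms prime_odd_nat by auto
  have "even ((p - 1) div 2 * ((q - 1) div 2)) \<longleftrightarrow> p mod 4 = 1 \<or> q mod 4 = 1"
  proof -
    have "even ((p - 1) div 2) \<longleftrightarrow> p mod 4 = 1" "even ((q - 1) div 2) \<longleftrightarrow> q mod 4 = 1"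
      using odd by presburger+
    then show ?thesis by simp
  qed
  then have "Legendre (int p) (int q) * Legendre (int q) (int p) = (if p mod 4 = 1 \<or> q mod 4 = 1 then 1 else -1)"
    using Quadratic_Reciprocity[OF assms] by (simp add: minus_one_power_iff)
  then show ?thesis
    by (auto simp: Legendre_def split: if_splits)
qed

subsection \<open>Forms with a given first coefficient\<close>

lemma squarefree_dvdI:
  fixes N X :: nat
  assumes "squarefree N" "N > 0" "\<And>l. prime l \<Longrightarrow> l dvd N \<Longrightarrow> l dvd X"
  shows "N dvd X"
proof (cases "X = 0")
  case False
  show ?thesis
  proof (rule multiplicity_le_imp_dvd)
    fix l :: nat assume l: "prime l"
    show "multiplicity l N \<le> multiplicity l X"
    proof (cases "l dvd N")
      case True
      have "multiplicity l N = 1"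
        using assms(1,2) l True by (auto simp: squarefree_factorial_semiring' in_prime_factors_iff)
      moreover have "multiplicity l X > 0"
        using assms(3)[OF l True] l False by (simp add: prime_multiplicity_gt_zero_iff)
      ultimately show ?thesis by linarith
    qed (simp add: not_dvd_imp_multiplicity_0)
  qed (use assms(2) in auto)
qed simp

lemma squarefree_prod_prime_factors:
  fixes N :: nat
  assumes "squarefree N" "N > 0"
  shows "\<Prod>(prime_factors N) = N"
proof -
  have "multiplicity p N = 1" if "p \<in> prime_factors N" for p
    using assms that by (auto simp: squarefree_factorial_semiring')
  then have "(\<Prod>p\<in>prime_factors N. p ^ multiplicity p N) = \<Prod>(prime_factors N)"
    by (intro prod.cong) auto
  then show ?thesis using prime_factorization_nat[of N] assms by simp
qed

lemma Legendre_one: "prime p \<Longrightarrow> Legendre 1 p = 1" for p :: int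
  using Legendre_square[of p 1] by (auto simp: zdvd1_eq prime_int_iff)

lemma Legendre_prod:
  assumes "prime q" "2 < q" "finite A"
  shows "Legendre (int (\<Prod>A)) (int q) = (\<Prod>l\<in>A. Legendre (int l) (int q))"
  using assms(3) by (induction A rule: finite_induct) (simp_all add: Legendre_one Legendre_mult assms)

lemma Legendre_nonzero: "\<not> p dvd a \<Longrightarrow> Legendre a p \<in> {-1, 1}" for p a :: int
  by (auto simp: Legendre_def cong_0_iff)

lemma prod_sign: "finite A \<Longrightarrow> (\<And>i. i \<in> A \<Longrightarrow> f i \<in> {-1, 1 :: int}) \<Longrightarrow> prod f A \<in> {-1, 1}"
  by (induction A rule: finite_induct) fastforce+

text \<open>Modulo an odd prime \<open>l\<close> the hypothesis makes \<open>- E * q\<close> a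
  square \<open>y^2\<close>, and \<open>s = y / q\<close> is a solution; modulo 2,
  \<open>s = 1\<close> is one. The solutions are glued over the prime factors of
  \<open>N\<close>.\<close>

lemma ex_sqrt_mod_squarefree:
  fixes N E q :: nat
  assumes N: "squarefree N" "N > 0"
    and odd_prime: "\<And>l. prime l \<Longrightarrow> 2 < l \<Longrightarrow> l dvd N \<Longrightarrow> Legendre (- int E) (int l) = Legendre (int q) (int l) \<and> \<not> l dvd q \<and> \<not> l dvd E"
    and two: "even N \<Longrightarrow> odd E \<and> odd q"
  shows "\<exists>s. N dvd E + q * s\<^sup>2"
proof -
  have "\<exists>s. l dvd E + q * s\<^sup>2" if l: "prime l" "l dvd N" for l
  proof (cases "l = 2")
    case True
    then show ?thesis using two l by (intro exI[of _ 1]) auto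
  next
    case False
    then have l2: "2 < l" using l prime_ge_2_nat[of l] by linarith
    have leg: "Legendre (- int E) (int l) = Legendre (int q) (int l)" and nd: "\<not> l dvd q" "\<not> l dvd E"
      using odd_prime l l2 by auto
    have "Legendre (int q) (int l) \<in> {-1, 1}" using nd by (intro Legendre_nonzero) simp
    then have "Legendre (- int E * int q) (int l) = 1"
      using leg Legendre_mult[OF l(1) l2, of "- int E" "int q"] by auto
    then obtain y where y: "int l dvd y\<^sup>2 - (- int E * int q)" by (rule Legendre_eq_1D)
    have "coprime q l" using nd l by (metis coprime_commute prime_imp_coprime)
    then obtain u where "[int q * u = 1] (mod int l)" using cong_solve_coprime_int[of "int q" "int l"] by auto
    then obtain m where m: "int q * u - 1 = int l * m" by (auto simp: cong_iff_dvd_diff)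
    define s where "s = nat ((u * y) mod int l)"
    have "[int s = u * y] (mod int l)" using l by (simp add: s_def Cong.cong_def prime_gt_0_nat)
    then have "[int E + int q * (int s)\<^sup>2 = int E + int q * (u * y)\<^sup>2] (mod int l)"
      by (intro cong_add cong_mult cong_pow cong_refl)
    moreover have "int l dvd int E + int q * (u * y)\<^sup>2"
    proof -
      obtain k where "y\<^sup>2 - (- int E * int q) = int l * k" using y by (rule dvdE)
      then have k: "y\<^sup>2 = int l * k - int E * int q" by simp
      have "int E + int q * (u * y)\<^sup>2 = int E + int q * u\<^sup>2 * y\<^sup>2" by (simp add: power_mult_distrib)
      also have "\<dots> = int l * (int q * u\<^sup>2 * k) + int E * (1 - (int q * u)\<^sup>2)"
        unfolding k by (simp add: algebra_simps power2_eq_square)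
      also have "1 - (int q * u)\<^sup>2 = - (int q * u - 1) * (int q * u + 1)"
        by (simp add: algebra_simps power2_eq_square)
      also have "\<dots> = int l * (- m * (int q * u + 1))" unfolding m by simp
      finally show ?thesis by simp
    qed
    ultimately have "int l dvd int E + int q * (int s)\<^sup>2" by (metis cong_0_iff cong_trans)
    then have "l dvd E + q * s\<^sup>2"
      by (metis of_nat_add of_nat_dvd_iff of_nat_mult of_nat_power)
    then show ?thesis by blast
  qed
  then obtain t where t: "\<And>l. prime l \<Longrightarrow> l dvd N \<Longrightarrow> l dvd E + q * (t l)\<^sup>2" by metis
  have "\<exists>s. \<forall>l\<in>prime_factors N. [s = t l] (mod l)"
    by (rule chinese_remainder_nat) (auto intro: primes_coprime)
  then obtain s where s: "\<And>l. l \<in> prime_factors N \<Longrightarrow> [s = t l] (mod l)" by blast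
  have "N dvd E + q * s\<^sup>2"
  proof (rule squarefree_dvdI[OF N])
    fix l assume l: "prime l" "l dvd N"
    then have "[s = t l] (mod l)" using s N by (auto simp: in_prime_factors_iff)
    then have "[E + q * s\<^sup>2 = E + q * (t l)\<^sup>2] (mod l)"
      by (intro cong_add cong_mult cong_pow cong_refl)
    then show "l dvd E + q * s\<^sup>2" using t[OF l] by (simp add: cong_dvd_iff)
  qed
  then show ?thesis by blast
qed

lemma shift_parity:
  fixes N E q s :: nat
  assumes "N dvd E + q * s\<^sup>2" "odd N"
  shows "\<exists>s. N dvd E + q * s\<^sup>2 \<and> (even s \<longleftrightarrow> P)"
proof (cases "even s \<longleftrightarrow> P")
  case False
  have "E + q * (s + N)\<^sup>2 = (E + q * s\<^sup>2) + N * (q * (2 * s + N))"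
    by (simp add: power2_eq_square algebra_simps)
  then have "N dvd E + q * (s + N)\<^sup>2" using assms by (metis dvd_add dvd_triv_left)
  moreover have "even (s + N) \<longleftrightarrow> P" using False assms by auto
  ultimately show ?thesis by blast
qed (use assms in blast)

text \<open>Modulo \<open>q\<close>, \<open>b\<close> is \<open>D / N\<close>, so \<open>-b\<close>
  equals \<open>- D * N / N^2\<close> and \<open>h = y / N\<close> is a root. Its residue modulo 4
  is still free and is fixed by the Chinese remainder theorem.\<close>

lemma ex_sqrt_mod_prime:
  fixes q :: nat and N D b r :: int
  assumes q: "prime q" "2 < q" and "\<not> int q dvd N" "Legendre (- (D * N)) (int q) = 1" "int q dvd N * b - D"
  shows "\<exists>h. int q dvd b + h\<^sup>2 \<and> [h = r] (mod 4)"
proof -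
  obtain y where y: "int q dvd y\<^sup>2 - (- (D * N))" using assms(4) by (rule Legendre_eq_1D)
  have "coprime (int q) N" using assms by (intro prime_imp_coprime) auto
  then obtain u where "[N * u = 1] (mod int q)" using cong_solve_coprime_int[of N "int q"] by (auto simp: coprime_commute)
  then have u: "int q dvd N * u - 1" by (simp add: cong_iff_dvd_diff)
  have "odd q" using q prime_odd_nat by auto
  then have "coprime (int q) (2 ^ 2)" by (simp only: coprime_power_right_iff coprime_right_2_iff_odd) simp
  then obtain h where h: "[h = u * y] (mod int q)" "[h = r] (mod 4)"
    using binary_chinese_remainder_int[of "int q" 4 "u * y" r] by auto
  have "b + (u * y)\<^sup>2 = u\<^sup>2 * (y\<^sup>2 - (- (D * N))) - b * (N * u - 1) * (N * u + 1) + N * u\<^sup>2 * (N * b - D)"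
    by (simp add: algebra_simps power2_eq_square)
  then have "int q dvd b + (u * y)\<^sup>2"
    using u y assms(5) by (simp add: dvd_diff dvd_add)
  moreover have "[b + h\<^sup>2 = b + (u * y)\<^sup>2] (mod int q)"
    using h by (intro cong_add cong_pow cong_refl)
  ultimately have "int q dvd b + h\<^sup>2" using cong_dvd_iff by blast
  then show ?thesis using h(2) by blast
qed

lemma odd_square_mod_8: "odd s \<Longrightarrow> s\<^sup>2 mod 8 = 1" for s :: nat
  using odd_mod_8[of s] by (subst power_mod[symmetric]) auto

lemma odd_square_mod_8_int: "odd s \<Longrightarrow> s\<^sup>2 mod 8 = 1" for s :: int
proof -
  assume "odd s"
  then have "s mod 8 \<in> {1, 3, 5, 7}" by simp presburger
  then show ?thesis by (subst power_mod[symmetric]) auto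
qed


lemma prime_factors_gt_2:
  fixes N :: nat
  assumes "odd N" "l \<in> prime_factors N"
  shows "prime l" "2 < l" "l dvd N"
proof -
  show l: "prime l" "l dvd N" using assms by auto
  then have "odd l" using assms(1) dvd_trans by blast
  then show "2 < l" using l prime_ge_2_nat[of l] by (cases "l = 2") auto
qed

lemma prime_not_dvd_lt: "prime q \<Longrightarrow> n < q \<Longrightarrow> n > 0 \<Longrightarrow> \<not> q dvd n" for q n :: nat
  by (auto dest: dvd_imp_le)

text \<open>In the following three lemmas \<open>b = 4 a c - h\<^sup>2\<close> must satisfy \<open>N b = D + a s\<^sup>2\<close>, and \<open>-b\<close> must be a
  square modulo \<open>4 a\<close>. The former prescribes \<open>(a/l)\<close> for the primes \<open>l\<close> dividing \<open>N\<close>; the latter amounts to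
  \<open>(-D N/a) = 1\<close>, which by reciprocity fixes one further character of \<open>a\<close>.\<close>

lemma ex_form_odd_prime:
  fixes N p :: nat
  assumes p: "prime p" "2 < p" and N: "squarefree N" "N > 0" "odd N" "coprime N p" "4 dvd N + p"
  shows "\<exists>(a::int) (c::int) (h::int) (s::int). a > 0 \<and> int N * (4 * a * c - h\<^sup>2) - a * s\<^sup>2 = int p \<and> even s"
proof -
  define P where "P = prime_factors N"
  have P: "prime l" "2 < l" "l dvd N" if "l \<in> P" for l
    using prime_factors_gt_2[OF N(3)] that unfolding P_def by blast+
  have P_ndvd: "\<not> l dvd p" if "l \<in> P" for l
    using P[OF that] N(4) p by (metis coprime_common_divisor not_prime_unit)
  have "p \<notin> P" using P_ndvd[of p] by auto
  \<comment> \<open>Since \<open>(q/l) = (-p/l)\<close> is forced, reciprocity makes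
    \<open>(N/q)\<close> equal to \<sigma>. The free symbol \<open>(q/p) = (p/q)\<close> is
    therefore prescribed as \<sigma> too, so that \<open>(-p N/q) = 1\<close>. Taking
    \<open>q = 1\<close> modulo 8 removes all signs from reciprocity.\<close>
  define \<sigma> where "\<sigma> = (\<Prod>l\<in>P. Legendre (- int p) (int l))"
  have leg: "Legendre (- int p) (int l) \<in> {-1, 1}" if "l \<in> P" for l
    using P_ndvd[OF that] by (intro Legendre_nonzero) simp
  have \<sigma>: "\<sigma> \<in> {-1, 1}" unfolding \<sigma>_def using leg by (intro prod_sign) (auto simp: P_def)
  have "\<exists>q>N + p. prime q \<and> [q = 1] (mod 8) \<and>
      (\<forall>l\<in>insert p P. Legendre (int q) (int l) = (if l = p then \<sigma> else Legendre (- int p) (int l)))"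
    using P p leg \<sigma> by (intro ex_prime_Legendre) (auto simp: P_def)
  then obtain q where q: "q > N + p" "prime q" "[q = 1] (mod 8)" "Legendre (int q) (int p) = \<sigma>"
    and ql': "\<forall>l\<in>P. Legendre (int q) (int l) = (if l = p then \<sigma> else Legendre (- int p) (int l))"
    by auto
  have ql: "Legendre (int q) (int l) = Legendre (- int p) (int l)" if "l \<in> P" for l
    using ql' that \<open>p \<notin> P\<close> by force
  have q8: "q mod 8 = 1" using q(3) by (simp add: Cong.cong_def)
  then have q4: "q mod 4 = 1" by presburger
  have "2 < q" using q p by linarith
  have lq: "l \<noteq> q" if "l \<in> P" for l using P(3)[OF that] q(1) N(2) by (auto dest: dvd_imp_le)
  have "\<exists>s. N dvd p + q * s\<^sup>2"
  proof (rule ex_sqrt_mod_squarefree[OF N(1,2)])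
    fix l assume l: "prime l" "2 < l" "l dvd N"
    then have "l \<in> P" using N by (simp add: P_def in_prime_factors_iff)
    moreover have "\<not> l dvd q" using lq[OF \<open>l \<in> P\<close>] q(2) l by (metis primes_dvd_imp_eq)
    ultimately show "Legendre (- int p) (int l) = Legendre (int q) (int l) \<and> \<not> l dvd q \<and> \<not> l dvd p"
      using ql P_ndvd by simp
  qed (use N in auto)
  then obtain s where s: "N dvd p + q * s\<^sup>2" "even s"
    using shift_parity[of N p q _ True] N by blast
  then obtain b where b: "p + q * s\<^sup>2 = N * b" by blast
  have "Legendre (- (int p * int N)) (int q) = Legendre (-1) (int q) * (Legendre (int p) (int q) * Legendre (int N) (int q))"
    using Legendre_mult[OF q(2) \<open>2 < q\<close>, of "-1" "int p * int N"] by (simp add: Legendre_mult q \<open>2 < q\<close>)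
  also have "Legendre (int p) (int q) = \<sigma>"
    using Legendre_reciprocity[OF p q(2) \<open>2 < q\<close>] q q4 by simp
  also have "Legendre (int N) (int q) = (\<Prod>l\<in>P. Legendre (int l) (int q))"
    using Legendre_prod[OF q(2) \<open>2 < q\<close>, of P] squarefree_prod_prime_factors[OF N(1,2)] by (simp add: P_def)
  also have "\<dots> = \<sigma>"
    unfolding \<sigma>_def using Legendre_reciprocity[OF _ _ q(2) \<open>2 < q\<close>] P lq ql q4 by (intro prod.cong) auto
  finally have "Legendre (- (int p * int N)) (int q) = 1"
    using \<sigma> Legendre_minus_one[OF q(2) \<open>2 < q\<close>] q4 by auto
  moreover have "\<not> int q dvd int N" using prime_not_dvd_lt[OF q(2)] q(1) N by simp
  moreover have b': "int N * int b = int p + int q * (int s)\<^sup>2"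
    using arg_cong[OF b, of int] by simp
  then have "int q dvd int N * int b - int p" by simp
  ultimately obtain h where h: "int q dvd int b + h\<^sup>2" "[h = 1] (mod 4)"
    using ex_sqrt_mod_prime[OF q(2) \<open>2 < q\<close>] by blast
  \<comment> \<open>As \<open>s\<close> is even, \<open>N * b = p = - N\<close> modulo 4, so
    \<open>b\<close> is -1 modulo 4 and an odd \<open>h\<close> fits.\<close>
  have "4 dvd int b + h\<^sup>2"
  proof -
    obtain k where k: "s = 2 * k" using s(2) by blast
    obtain n where n: "N + p = 4 * n" using N(5) by blast
    have "N * (b + 1) = 4 * (n + q * k\<^sup>2)" using b n by (simp add: k power2_eq_square algebra_simps)
    then have "4 dvd N * (b + 1)" by (metis dvd_triv_left)
    moreover have "coprime (2 ^ 2) N" using N(3) by (simp only: coprime_power_left_iff coprime_left_2_iff_odd) simp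
    then have "coprime 4 N" by simp
    ultimately have "4 dvd b + 1" using coprime_dvd_mult_right_iff by blast
    moreover have "odd h" using h(2) unfolding Cong.cong_def by presburger
    then have "h\<^sup>2 mod 8 = 1" by (rule odd_square_mod_8_int)
    ultimately show ?thesis by presburger
  qed
  moreover have "coprime 4 (int q)"
  proof -
    have "coprime (2 ^ 2) (int q)" using q4 by (simp only: coprime_power_left_iff coprime_left_2_iff_odd) presburger
    then show ?thesis by simp
  qed
  ultimately have "4 * int q dvd int b + h\<^sup>2" using h(1) by (intro divides_mult)
  then obtain c where "int b + h\<^sup>2 = 4 * int q * c" by blast
  then have "4 * int q * c - h\<^sup>2 = int b" by simp
  then have "int N * (4 * int q * c - h\<^sup>2) - int q * (int s)\<^sup>2 = int p" using b' by simp
  moreover have "int q > 0" using \<open>2 < q\<close> by simp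
  moreover have "even (int s)" using s(2) by simp
  ultimately show ?thesis by (intro exI conjI)
qed


lemma ex_form_2:
  fixes N :: nat
  assumes N: "squarefree N" "N > 0" "odd N"
  shows "\<exists>(a::int) (c::int) (h::int) (s::int). a > 0 \<and> int N * (4 * a * c - h\<^sup>2) - a * s\<^sup>2 = 2"
proof -
  define P where "P = prime_factors N"
  have P: "prime l" "2 < l" "l dvd N" if "l \<in> P" for l
    using prime_factors_gt_2[OF N(3)] that unfolding P_def by blast+
  have leg: "Legendre (-1) (int l) \<in> {-1, 1}" if "l \<in> P" for l
    using P[OF that] by (intro Legendre_nonzero) auto
  define \<sigma> where "\<sigma> = (\<Prod>l\<in>P. Legendre (-1) (int l))"
  have \<sigma>: "\<sigma> \<in> {-1, 1}" unfolding \<sigma>_def using leg by (intro prod_sign) (auto simp: P_def)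
  \<comment> \<open>Here \<open>a = 2 * q\<close>, so the condition at \<open>l\<close> becomes
    \<open>(q/l) = (-1/l)\<close>. For \<open>q = 1\<close> modulo 4 the symbol
    \<open>(-2 N/q)\<close> is \<open>(2/q) * \<sigma>\<close>, and the choice between 1 and 5
    modulo 8 makes \<open>(2/q) = \<sigma>\<close>.\<close>
  define e :: nat where "e = (if \<sigma> = 1 then 1 else 5)"
  have "\<exists>q>N. prime q \<and> [q = e] (mod 8) \<and> (\<forall>l\<in>P. Legendre (int q) (int l) = Legendre (-1) (int l))"
    using P leg by (intro ex_prime_Legendre) (auto simp: P_def e_def)
  then obtain q where q: "q > N" "prime q" "[q = e] (mod 8)"
    and ql: "\<And>l. l \<in> P \<Longrightarrow> Legendre (int q) (int l) = Legendre (-1) (int l)" by auto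
  have q8: "q mod 8 = e" using q(3) by (simp add: Cong.cong_def e_def split: if_splits)
  then have q4: "q mod 4 = 1" unfolding e_def by (simp split: if_splits; presburger)
  then have "odd q" by presburger
  then have "2 < q" using q prime_ge_2_nat[of q] by (cases "q = 2") auto
  have lq: "l \<noteq> q" if "l \<in> P" for l using P(3)[OF that] q(1) N(2) by (auto dest: dvd_imp_le)
  have "\<exists>s. N dvd 1 + q * s\<^sup>2"
  proof (rule ex_sqrt_mod_squarefree[OF N(1,2)])
    fix l assume l: "prime l" "2 < l" "l dvd N"
    then have "l \<in> P" using N by (simp add: P_def in_prime_factors_iff)
    moreover have "\<not> l dvd q" using lq[OF \<open>l \<in> P\<close>] q(2) l by (metis primes_dvd_imp_eq)
    ultimately show "Legendre (- int 1) (int l) = Legendre (int q) (int l) \<and> \<not> l dvd q \<and> \<not> l dvd 1"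
      using ql l by simp
  qed (use N in auto)
  then obtain s where s: "N dvd 1 + q * s\<^sup>2" "odd s"
    using shift_parity[of N 1 q _ False] N by blast
  then obtain m where m: "1 + q * s\<^sup>2 = N * m" by blast
  define b where "b = 2 * m"
  have b: "int N * int b = 2 + 2 * int q * (int s)\<^sup>2"
    using arg_cong[OF m, of "\<lambda>x. 2 * int x"] by (simp add: b_def)
  have "Legendre (- (2 * int N)) (int q) = Legendre (-1) (int q) * (Legendre 2 (int q) * Legendre (int N) (int q))"
    using Legendre_mult[OF q(2) \<open>2 < q\<close>, of "-1" "2 * int N"] by (simp add: Legendre_mult q \<open>2 < q\<close>)
  also have "Legendre (int N) (int q) = (\<Prod>l\<in>P. Legendre (int l) (int q))"
    using Legendre_prod[OF q(2) \<open>2 < q\<close>, of P] squarefree_prod_prime_factors[OF N(1,2)] by (simp add: P_def)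
  also have "\<dots> = \<sigma>"
    unfolding \<sigma>_def using Legendre_reciprocity[OF _ _ q(2) \<open>2 < q\<close>] P lq ql q4 by (intro prod.cong) auto
  finally have "Legendre (- (2 * int N)) (int q) = 1"
    using \<sigma> Legendre_minus_one[OF q(2) \<open>2 < q\<close>] Legendre_two[OF q(2) q4] q4 q8 by (auto simp: e_def)
  moreover have "\<not> int q dvd int N" using prime_not_dvd_lt[OF q(2)] q(1) N by simp
  moreover have "int q dvd int N * int b - 2" unfolding b by simp
  ultimately obtain h where h: "int q dvd int b + h\<^sup>2" "[h = 2] (mod 4)"
    using ex_sqrt_mod_prime[OF q(2) \<open>2 < q\<close>] by blast
  \<comment> \<open>\<open>4 * a\<close> is \<open>8 * q\<close>. Odd \<open>s\<close> and
    \<open>q = 1\<close> modulo 4 force \<open>m = 2\<close> modulo 4, so \<open>b\<close> and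
    \<open>h^2\<close> are both 4 modulo 8.\<close>
  have "8 dvd int b + h\<^sup>2"
  proof -
    have "even (N * m)" unfolding m[symmetric] using s(2) \<open>odd q\<close> by simp
    moreover have "(q * s\<^sup>2) mod 4 = 1"
      using q4 odd_square_mod_8[OF s(2)] by (subst mod_mult_eq[symmetric]) (simp, presburger)
    then have "(N * m) mod 4 = 2" unfolding m[symmetric] by presburger
    ultimately have "m mod 4 = 2" 
    proof -
      have "even m" using \<open>even (N * m)\<close> N(3) by simp
      then obtain j where "m = 2 * j" by blast
      moreover have "odd j" using \<open>(N * m) mod 4 = 2\<close> \<open>m = 2 * j\<close> by (auto elim!: evenE)
      ultimately show ?thesis by presburger
    qed
    then have "b mod 8 = 4" unfolding b_def by presburger
    moreover obtain j where j: "h = 2 * j" "odd j"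
    proof (rule that)
      have "h mod 4 = 2" using h(2) by (simp add: Cong.cong_def)
      then show "h = 2 * (h div 2)" "odd (h div 2)" by presburger+
    qed
    ultimately show ?thesis
      using odd_square_mod_8_int[OF j(2)] by (simp add: power_mult_distrib) presburger
  qed
  moreover have "coprime 8 (int q)"
  proof -
    have "coprime (2 ^ 3) (int q)" using \<open>odd q\<close> by (simp only: coprime_power_left_iff coprime_left_2_iff_odd) simp
    then show ?thesis by simp
  qed
  ultimately have "8 * int q dvd int b + h\<^sup>2" using h(1) by (intro divides_mult)
  then obtain c where "int b + h\<^sup>2 = 8 * int q * c" by blast
  then have "4 * (2 * int q) * c - h\<^sup>2 = int b" by simp
  then have "int N * (4 * (2 * int q) * c - h\<^sup>2) - (2 * int q) * (int s)\<^sup>2 = 2" using b by simp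
  moreover have "2 * int q > 0" using \<open>2 < q\<close> by simp
  ultimately show ?thesis by (intro exI conjI)
qed


lemma prod_minus_one_mod_4:
  fixes A :: "nat set"
  assumes "finite A" "\<And>l. l \<in> A \<Longrightarrow> odd l"
  shows "(\<Prod>l\<in>A. if l mod 4 = 1 then 1 else -1 :: int) = (if \<Prod>A mod 4 = 1 then 1 else -1) \<and> odd (\<Prod>A)"
  using assms
proof (induction A rule: finite_induct)
  case (insert x A)
  have r: "k mod 4 \<in> {1, 3}" if "odd k" for k :: nat using that by simp presburger
  have "odd x" "odd (\<Prod>A)" using insert by auto
  then show ?case
    using insert r[OF \<open>odd x\<close>] r[OF \<open>odd (\<Prod>A)\<close>] mod_mult_eq[of x 4 "\<Prod>A"] by auto
qed simp

lemma ex_form_5: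
  fixes N :: nat
  assumes N: "squarefree N" "N > 0" "coprime N 5" "even N \<or> N mod 4 = 1"
  shows "\<exists>(a::int) (c::int) (h::int) (s::int). a > 0 \<and> int N * (4 * a * c - h\<^sup>2) - a * s\<^sup>2 = 5"
proof -
  define N' where "N' = (if even N then N div 2 else N)"
  have N': "odd N'" "squarefree N'" "N' > 0"
  proof -
    have "\<not> 2\<^sup>2 dvd N" using N(1) unfolding squarefree_def by (metis nat_dvd_1_iff_1 numeral_eq_one_iff semiring_norm(85))
    then have "\<not> 4 dvd N" by simp
    then show "odd N'" unfolding N'_def by (simp; presburger)
    have "N' dvd N" by (auto simp: N'_def)
    then show "squarefree N'" using N(1) squarefree_mono by blast
    show "N' > 0" using \<open>odd N'\<close> by (auto intro: Nat.gr0I)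
  qed
  have N'_dvd: "N' dvd N" by (auto simp: N'_def)
  define P where "P = prime_factors N'"
  have P: "prime l" "2 < l" "l dvd N'" if "l \<in> P" for l
    using prime_factors_gt_2[OF N'(1)] that unfolding P_def by blast+
  have P_ndvd: "\<not> l dvd 5" if "l \<in> P" for l
    using P[OF that] N'_dvd N(3) by (metis coprime_common_divisor dvd_trans not_prime_unit)
  have "5 \<notin> P" using P_ndvd[of 5] by auto
  have leg: "Legendre (-5) (int l) \<in> {-1, 1}" if "l \<in> P" for l
    using P_ndvd[OF that] by (intro Legendre_nonzero) (metis int_dvd_int_iff dvd_minus_iff of_nat_numeral)
  define \<sigma> where "\<sigma> = (\<Prod>l\<in>P. Legendre (-5) (int l))"
  have \<sigma>: "\<sigma> \<in> {-1, 1}" unfolding \<sigma>_def using leg by (intro prod_sign) (auto simp: P_def)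
  \<comment> \<open>The residue of \<open>q\<close> is chosen so that
    \<open>N * b = 5 + q * s^2\<close> with odd \<open>s\<close> gives \<open>b = 3\<close> modulo 4
    for even \<open>N\<close> and \<open>b = 0\<close> for odd \<open>N\<close>, the classes with
    \<open>-b\<close> a square modulo 4. The sign \<delta> is \<open>(2/q)\<close> for even
    \<open>N\<close> and \<open>(-1/q)\<close> for odd \<open>N\<close>; prescribing
    \<open>(q/5) = \<delta> * \<sigma>\<close> cancels it.\<close>
  define e :: nat where "e = (if odd N then 3 else if N' mod 4 = 1 then 1 else 5)"
  define \<delta> :: int where "\<delta> = (if e = 1 then 1 else -1)"
  have "\<exists>q>N + 5. prime q \<and> [q = e] (mod 8) \<and>
      (\<forall>l\<in>insert 5 P. Legendre (int q) (int l) = (if l = 5 then \<delta> * \<sigma> else Legendre (-5) (int l)))"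
    using P leg \<sigma> by (intro ex_prime_Legendre) (auto simp: P_def e_def \<delta>_def)
  then obtain q where q: "q > N + 5" "prime q" "[q = e] (mod 8)" "Legendre (int q) 5 = \<delta> * \<sigma>"
    and ql': "\<forall>l\<in>P. Legendre (int q) (int l) = (if l = 5 then \<delta> * \<sigma> else Legendre (-5) (int l))"
    by auto
  have ql: "Legendre (int q) (int l) = Legendre (-5) (int l)" if "l \<in> P" for l
    using ql' that \<open>5 \<notin> P\<close> by force
  have q8: "q mod 8 = e" using q(3) by (simp add: Cong.cong_def e_def split: if_splits)
  have "odd q" using q8 unfolding e_def by (simp split: if_splits; presburger)
  have "2 < q" using q by simp
  have lq: "l \<noteq> q" if "l \<in> P" for l
    using P(3)[OF that] N'_dvd q(1) N(2) by (meson add_lessD1 dvd_imp_le dvd_trans linorder_not_less)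
  have "\<exists>s. N dvd 5 + q * s\<^sup>2"
  proof (rule ex_sqrt_mod_squarefree[OF N(1,2)])
    fix l assume l: "prime l" "2 < l" "l dvd N"
    have "l dvd N'"
    proof (cases "even N")
      case True
      then have "l dvd 2 * N'" using l by (simp add: N'_def)
      then show ?thesis using l by (auto simp: prime_dvd_mult_iff dest: dvd_imp_le)
    qed (use l in \<open>simp add: N'_def\<close>)
    then have "l \<in> P" using l N' by (simp add: P_def in_prime_factors_iff)
    moreover have "\<not> l dvd q" using lq[OF \<open>l \<in> P\<close>] q(2) l by (metis primes_dvd_imp_eq)
    ultimately show "Legendre (- int 5) (int l) = Legendre (int q) (int l) \<and> \<not> l dvd q \<and> \<not> l dvd 5"
      using ql P_ndvd by simp
  qed (use \<open>odd q\<close> in auto)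
  moreover have "odd s" if "N dvd 5 + q * s\<^sup>2" "even N" for s
  proof -
    have "even (5 + q * s\<^sup>2)" using that dvd_trans by blast
    then show ?thesis using \<open>odd q\<close> by simp
  qed
  ultimately obtain s where s: "N dvd 5 + q * s\<^sup>2" "odd s"
    using shift_parity[of N 5 q _ False] by blast
  then obtain b where b: "5 + q * s\<^sup>2 = N * b" by blast
  have b': "int N * int b = 5 + int q * (int s)\<^sup>2"
    using arg_cong[OF b, of int] by simp
  have s8: "(q * s\<^sup>2) mod 8 = e"
    using q8 odd_square_mod_8[OF s(2)] by (subst mod_mult_eq[symmetric]) (simp add: e_def)
  have "prime (5::nat)" by simp
  have leg5: "Legendre 5 (int q) = \<delta> * \<sigma>"
    using Legendre_reciprocity[OF \<open>prime (5::nat)\<close> _ q(2) \<open>2 < q\<close>] q by simp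
  have legP: "Legendre (int N') (int q) = (\<Prod>l\<in>P. Legendre (int l) (int q))"
    using Legendre_prod[OF q(2) \<open>2 < q\<close>, of P] squarefree_prod_prime_factors[OF N'(2,3)] by (simp add: P_def)
  have split: "Legendre (- (5 * int N)) (int q) = Legendre (-1) (int q) * (Legendre 5 (int q) * Legendre (int N) (int q))"
    using Legendre_mult[OF q(2) \<open>2 < q\<close>, of "-1" "5 * int N"] by (simp add: Legendre_mult q \<open>2 < q\<close>)
  have "Legendre (- (5 * int N)) (int q) = 1 \<and> b mod 4 \<in> {0, 3}"
  proof (cases "even N")
    case True
    then have "int N = 2 * int N'" by (auto simp: N'_def)
    then have lN: "Legendre (int N) (int q) = Legendre 2 (int q) * Legendre (int N') (int q)"
      by (simp add: Legendre_mult q \<open>2 < q\<close>)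
    have q4: "q mod 4 = 1"
      using q8 True unfolding e_def by (simp split: if_splits; presburger)
    have lN': "Legendre (int N') (int q) = \<sigma>"
      unfolding legP \<sigma>_def using Legendre_reciprocity[OF _ _ q(2) \<open>2 < q\<close>] P lq ql q4 by (intro prod.cong) auto
    have l2: "Legendre 2 (int q) = \<delta>"
      unfolding Legendre_two[OF q(2) q4] q8 \<delta>_def by simp
    have lm: "Legendre (-1) (int q) = 1" using Legendre_minus_one[OF q(2) \<open>2 < q\<close>] q4 by simp
    have "\<delta> \<in> {-1, 1}" by (simp add: \<delta>_def)
    then have "Legendre (- (5 * int N)) (int q) = 1"
      unfolding split leg5 lN lN' l2 lm using \<sigma> by auto
    moreover have "b mod 4 = 3"
    proof -
      have r: "k mod 4 = 1 \<or> k mod 4 = 3" if "odd k" for k :: nat using that by presburger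
      have "2 * (N' * b) = 5 + q * s\<^sup>2" using b True by (simp add: N'_def mult.assoc[symmetric])
      then have Nb: "(N' * b) mod 4 = (if N' mod 4 = 1 then 3 else 1)"
        using s8 True unfolding e_def by (simp split: if_splits; presburger)
      then have "(N' * b) mod 4 = 3 \<or> (N' * b) mod 4 = 1" by simp
      then have "odd (N' * b)" by presburger
      then have "odd b" by simp
      have "((N' mod 4) * (b mod 4)) mod 4 = (if N' mod 4 = 1 then 3 else 1)"
        using Nb by (simp only: mod_mult_eq)
      then show ?thesis
        using r[OF \<open>odd b\<close>] r[OF N'(1)] by (elim disjE) simp_all
    qed
    ultimately show ?thesis by simp
  next
    case False
    then have N4: "N mod 4 = 1" and "N' = N" and e: "e = 3" using N(4) by (auto simp: N'_def e_def)
    have q4: "q mod 4 = 3" using q8 e by presburger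
    have "(\<Prod>l\<in>P. Legendre (int l) (int q)) = (\<Prod>l\<in>P. (if l mod 4 = 1 then 1 else -1) * Legendre (-5) (int l))"
      using Legendre_reciprocity[OF _ _ q(2) \<open>2 < q\<close>] P lq ql q4 by (intro prod.cong) auto
    also have "\<dots> = (\<Prod>l\<in>P. if l mod 4 = 1 then 1 else -1) * \<sigma>"
      unfolding \<sigma>_def by (rule prod.distrib)
    \<comment> \<open>Now \<open>q = 3\<close> modulo 4, so each prime factor 3 modulo 4 contributes
      a sign; as \<open>N = 1\<close> modulo 4, their number is even.\<close>
    also have "(\<Prod>l\<in>P. if l mod 4 = 1 then 1 else -1 :: int) = 1"
    proof -
      have "odd l" if "l \<in> P" for l using P[OF that] prime_odd_nat by blast
      then show ?thesis
        using prod_minus_one_mod_4[of P] squarefree_prod_prime_factors[OF N'(2,3)] N4 \<open>N' = N\<close>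
        by (simp add: P_def)
    qed
    finally have "Legendre (int N) (int q) = \<sigma>" using legP \<open>N' = N\<close> by simp
    then have "Legendre (- (5 * int N)) (int q) = 1"
      using split leg5 \<sigma> Legendre_minus_one[OF q(2) \<open>2 < q\<close>] q4 e by (auto simp: \<delta>_def)
    moreover have "b mod 4 = 0"
    proof -
      have "(N * b) mod 4 = 0" using s8 e b[symmetric] by presburger
      then have "4 dvd N * b" by presburger
      moreover have "coprime (2 ^ 2) N" using False by (simp only: coprime_power_left_iff coprime_left_2_iff_odd) simp
      ultimately show ?thesis by (simp add: coprime_dvd_mult_right_iff)
    qed
    ultimately show ?thesis by simp
  qed
  then have legN: "Legendre (- (5 * int N)) (int q) = 1" and b4: "b mod 4 = 0 \<or> b mod 4 = 3" by auto
  have "\<not> int q dvd int N" using prime_not_dvd_lt[OF q(2)] q(1) N by simp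
  moreover have "int q dvd int N * int b - 5" unfolding b' by simp
  \<comment> \<open>\<open>h = b\<close> serves both classes: \<open>b + b^2\<close> is divisible by
    4 for \<open>b = 0\<close> and \<open>b = 3\<close> modulo 4.\<close>
  ultimately obtain h where h: "int q dvd int b + h\<^sup>2" "[h = int b] (mod 4)"
    using legN ex_sqrt_mod_prime[OF q(2) \<open>2 < q\<close>] by blast
  have h4: "h mod 4 = int b mod 4" using h(2) by (simp add: Cong.cong_def)
  have "4 dvd int b + h\<^sup>2"
  proof (cases "b mod 4 = 0")
    case True
    then have "h mod 4 = 0" "int b mod 4 = 0" using h4 by presburger+
    then show ?thesis by (auto elim!: dvdE simp: mod_eq_0_iff_dvd power2_eq_square)
  next
    case False
    then have "b mod 4 = 3" using b4 by simp
    then have "odd h" using h4 by presburger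
    then have "h\<^sup>2 mod 8 = 1" by (rule odd_square_mod_8_int)
    then show ?thesis using \<open>b mod 4 = 3\<close> by presburger
  qed
  moreover have "coprime 4 (int q)"
  proof -
    have "coprime (2 ^ 2) (int q)" using \<open>odd q\<close> by (simp only: coprime_power_left_iff coprime_left_2_iff_odd) simp
    then show ?thesis by simp
  qed
  ultimately have "4 * int q dvd int b + h\<^sup>2" using h(1) by (intro divides_mult)
  then obtain c where "int b + h\<^sup>2 = 4 * int q * c" by blast
  then have "4 * int q * c - h\<^sup>2 = int b" by simp
  then have "int N * (4 * int q * c - h\<^sup>2) - int q * (int s)\<^sup>2 = 5" using b' by simp
  moreover have "int q > 0" using \<open>2 < q\<close> by simp
  ultimately show ?thesis by (intro exI conjI)
qed

subsection \<open>Reduction of ternary forms\<close>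

type_synonym form = "int \<times> int \<times> int \<times> int \<times> int \<times> int"

fun form_eval :: "form \<Rightarrow> int \<Rightarrow> int \<Rightarrow> int \<Rightarrow> int" where
  "form_eval (a, b, c, r, s, t) x y z = a * x * x + b * y * y + c * z * z + r * y * z + s * x * z + t * x * y"

text \<open>Half the determinant of the Hessian matrix.\<close>

fun form_disc :: "form \<Rightarrow> int" where
  "form_disc (a, b, c, r, s, t) = 4 * a * b * c + r * s * t - a * r\<^sup>2 - b * s\<^sup>2 - c * t\<^sup>2"

text \<open>The vector is in the radical of the polar form modulo 2.\<close>

fun even_gradient :: "form \<Rightarrow> int \<Rightarrow> int \<Rightarrow> int \<Rightarrow> bool" where
  "even_gradient (a, b, c, r, s, t) x y z \<longleftrightarrow>
     even (t * y + s * z) \<and> even (t * x + r * z) \<and> even (s * x + r * y)"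

text \<open>Reduction in the sense of Hermite: \<open>a\<close> is minimal, and the binary form
  \<open>(4 a b - t\<^sup>2, 4 a r - 2 s t, 4 a c - s\<^sup>2)\<close>, obtained by projecting orthogonally to the first basis vector, is reduced.\<close>

fun reduced_form :: "form \<Rightarrow> bool" where
  "reduced_form (a, b, c, r, s, t) \<longleftrightarrow> 0 < a \<and> 0 \<le> t \<and> t \<le> a \<and> 0 \<le> s \<and> s \<le> a \<and> a \<le> b \<and>
     \<bar>4 * a * r - 2 * s * t\<bar> \<le> 4 * a * b - t\<^sup>2 \<and> 4 * a * b - t\<^sup>2 \<le> 4 * a * c - s\<^sup>2"

lemma ex_small_shift: "m > 0 \<Longrightarrow> \<exists>k. \<bar>u + 2 * m * k\<bar> \<le> m" for m u :: int
proof -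
  assume m: "m > 0"
  define k where "k = - ((u + m) div (2 * m))"
  have "u + m = 2 * m * ((u + m) div (2 * m)) + (u + m) mod (2 * m)" by simp
  then have "u + 2 * m * k = (u + m) mod (2 * m) - m"
    unfolding k_def mult_minus_right by linarith
  moreover have "0 \<le> (u + m) mod (2 * m)" "(u + m) mod (2 * m) < 2 * m" using m by auto
  ultimately show ?thesis by (intro exI[of _ k]) linarith
qed

text \<open>Closure under generators of the unimodular substitutions, written on coefficients
  (\<open>shear12\<close> replaces \<open>x\<close> by \<open>x + k * y\<close>), so that minimal
  members can be chosen without handling matrices.\<close>

locale form_class =
  fixes P :: "form \<Rightarrow> bool"
  assumes swap12: "P (a, b, c, r, s, t) \<Longrightarrow> P (b, a, c, s, r, t)"
    and swap23: "P (a, b, c, r, s, t) \<Longrightarrow> P (a, c, b, r, t, s)"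
    and negate1: "P (a, b, c, r, s, t) \<Longrightarrow> P (a, b, c, r, - s, - t)"
    and shear12: "P (a, b, c, r, s, t) \<Longrightarrow> P (a, a * k\<^sup>2 + t * k + b, c, r + s * k, s, t + 2 * a * k)"
    and positive: "P (a, b, c, r, s, t) \<Longrightarrow> a > 0 \<and> 4 * a * b - t\<^sup>2 > 0"
begin

lemma shear13: "P (a, b, c, r, s, t) \<Longrightarrow> P (a, b, a * k\<^sup>2 + s * k + c, r + t * k, s + 2 * a * k, t)"
  using swap23 shear12 by blast

lemma shear23: "P (a, b, c, r, s, t) \<Longrightarrow> P (a, b, b * k\<^sup>2 + r * k + c, r + 2 * b * k, s + t * k, t)"
  using swap12 swap23 shear12 by meson

lemma negate2: "P (a, b, c, r, s, t) \<Longrightarrow> P (a, b, c, - r, s, - t)"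
  using swap12 negate1 by blast

lemma negate3: "P (a, b, c, r, s, t) \<Longrightarrow> P (a, b, c, - r, - s, t)"
  using swap23 negate2 by blast

text \<open>Take \<open>a\<close> minimal, then \<open>A = 4 a b - t^2\<close> minimal. Shears by
  \<open>k1\<close>, \<open>k2\<close>, \<open>k3\<close> normalize the middle coefficient of the
  projected form, then \<open>t\<close>, then \<open>s\<close>; each keeps \<open>a\<close>,
  \<open>A\<close> and the earlier normalizations. The inequalities \<open>a <= b\<close> and
  \<open>A <= 4 a c - s^2\<close> are minimality against forms with swapped variables.\<close>

lemma ex_reduced:
  assumes "P f0"
  shows "\<exists>f. P f \<and> reduced_form f"
proof -
  define fa where "fa f = nat (fst f)" for f :: form
  define fA where "fA f = (case f of (a, b, c, r, s, t) \<Rightarrow> nat (4 * a * b - t\<^sup>2))" for f :: form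
  obtain f1 where f1: "P f1" "\<And>f. P f \<Longrightarrow> fa f1 \<le> fa f"
    using ex_has_least_nat[of P f0 fa] assms by blast
  obtain f2 where f2: "P f2" "fa f2 = fa f1" "\<And>f. P f \<Longrightarrow> fa f = fa f1 \<Longrightarrow> fA f2 \<le> fA f"
    using ex_has_least_nat[of "\<lambda>f. P f \<and> fa f = fa f1" f1 fA] f1 by blast
  obtain a b c r s t where f2_eq: "f2 = (a, b, c, r, s, t)" by (cases f2) auto
  define A where "A = 4 * a * b - t\<^sup>2"
  have "a > 0" "A > 0" using positive f2 f2_eq by (auto simp: A_def)
  have min_a: "a \<le> a'" if "P (a', b', c', r', s', t')" for a' b' c' r' s' t'
    using f1(2)[OF that] positive[OF that] f2(2) \<open>a > 0\<close> by (simp add: fa_def f2_eq)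
  have min_A: "A \<le> 4 * a * b' - t'\<^sup>2" if "P (a, b', c', r', s', t')" for b' c' r' s' t'
    using f2(3)[OF that] positive[OF that] f2(2) \<open>A > 0\<close> by (simp add: fa_def fA_def f2_eq A_def)
  obtain k1 where k1: "\<bar>(4 * a * r - 2 * s * t) + 2 * A * k1\<bar> \<le> A"
    using ex_small_shift[OF \<open>A > 0\<close>] by blast
  define c1 r1 s1 where "c1 = b * k1\<^sup>2 + r * k1 + c" and "r1 = r + 2 * b * k1" and "s1 = s + t * k1"
  have 1: "P (a, b, c1, r1, s1, t)"
    using shear23 f2(1) unfolding f2_eq c1_def r1_def s1_def by blast
  have B1: "\<bar>4 * a * r1 - 2 * s1 * t\<bar> \<le> A"
    using k1 by (simp add: r1_def s1_def A_def algebra_simps power2_eq_square)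
  obtain k2 where k2: "\<bar>t + 2 * a * k2\<bar> \<le> a" using ex_small_shift[OF \<open>a > 0\<close>] by blast
  define b2 r2 t2 where "b2 = a * k2\<^sup>2 + t * k2 + b" and "r2 = r1 + s1 * k2" and "t2 = t + 2 * a * k2"
  have 2: "P (a, b2, c1, r2, s1, t2)"
    using shear12[OF 1] unfolding b2_def r2_def t2_def by blast
  have A2: "4 * a * b2 - t2\<^sup>2 = A"
    by (simp add: b2_def t2_def A_def algebra_simps power2_eq_square)
  have B2: "\<bar>4 * a * r2 - 2 * s1 * t2\<bar> \<le> A"
    using B1 by (simp add: r2_def t2_def algebra_simps)
  obtain k3 where k3: "\<bar>s1 + 2 * a * k3\<bar> \<le> a" using ex_small_shift[OF \<open>a > 0\<close>] by blast
  define c3 r3 s3 where "c3 = a * k3\<^sup>2 + s1 * k3 + c1" and "r3 = r2 + t2 * k3" and "s3 = s1 + 2 * a * k3"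
  have 3: "P (a, b2, c3, r3, s3, t2)"
    using shear13[OF 2] unfolding c3_def r3_def s3_def by blast
  have B3: "\<bar>4 * a * r3 - 2 * s3 * t2\<bar> \<le> A"
    using B2 by (simp add: r3_def s3_def algebra_simps)
  have "a \<le> b2" using min_a[OF swap12[OF 3]] .
  have "A \<le> 4 * a * c3 - s3\<^sup>2" using min_A[OF swap23[OF 3]] .
  have red: "reduced_form (a, b2, c3, r', s', t')"
    if "s' = \<bar>s3\<bar>" "t' = \<bar>t2\<bar>" "\<bar>4 * a * r' - 2 * s' * t'\<bar> = \<bar>4 * a * r3 - 2 * s3 * t2\<bar>" for r' s' t'
    using that k2 k3 B3 A2 \<open>a > 0\<close> \<open>a \<le> b2\<close> \<open>A \<le> 4 * a * c3 - s3\<^sup>2\<close> by (simp add: t2_def s3_def)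
  consider "s3 \<ge> 0" "t2 \<ge> 0" | "s3 \<ge> 0" "t2 \<le> 0" | "s3 \<le> 0" "t2 \<ge> 0" | "s3 \<le> 0" "t2 \<le> 0" by linarith
  then show ?thesis
  proof cases
    case 1
    then have "reduced_form (a, b2, c3, r3, s3, t2)" by (intro red) auto
    then show ?thesis using 3 by blast
  next
    case 2
    then have "reduced_form (a, b2, c3, - r3, s3, - t2)" by (intro red) (auto simp: abs_minus_commute)
    then show ?thesis using negate2[OF 3] by blast
  next
    case neg_s: 3
    then have "reduced_form (a, b2, c3, - r3, - s3, t2)" by (intro red) (auto simp: abs_minus_commute)
    then show ?thesis using negate3[OF 3] by blast
  next
    case 4
    then have "reduced_form (a, b2, c3, r3, - s3, - t2)" by (intro red) auto
    then show ?thesis using negate1[OF 3] by blast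
  qed
qed

end

text \<open>Collects what must survive reduction. Membership in the radical does not depend on the
  basis, so it can be carried along with the vector.\<close>

definition represented_by :: "int \<Rightarrow> bool \<Rightarrow> int \<Rightarrow> form \<Rightarrow> bool" where
  "represented_by D rad N f \<longleftrightarrow> form_disc f = D \<and>
     (\<forall>x y z. (x, y, z) \<noteq> (0, 0, 0) \<longrightarrow> form_eval f x y z > 0) \<and>
     (\<exists>x y z. form_eval f x y z = N \<and> (rad \<longrightarrow> even_gradient f x y z))"

lemma form_class_represented_by: "form_class (represented_by D rad N)"
proof
  fix a b c r s t k :: int
  assume P: "represented_by D rad N (a, b, c, r, s, t)"
  let ?f = "(a, b, c, r, s, t) :: form"
  have pos: "form_eval ?f x y z > 0" if "(x, y, z) \<noteq> (0, 0, 0)" for x y z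
    using P that unfolding represented_by_def by blast
  obtain x y z where xyz: "form_eval ?f x y z = N" "rad \<longrightarrow> even_gradient ?f x y z"
    using P unfolding represented_by_def by blast
  have disc: "form_disc ?f = D" using P by (simp add: represented_by_def)
  have transfer: "represented_by D rad N g"
    if disc': "form_disc g = D" and eq: "\<And>x y z. form_eval g x y z = form_eval ?f (X x y z) (Y x y z) (Z x y z)"
      and inj: "\<And>x y z. (X x y z, Y x y z, Z x y z) = (0, 0, 0) \<Longrightarrow> (x, y, z) = (0, 0, 0)"
      and ex: "\<exists>x' y' z'. X x' y' z' = x \<and> Y x' y' z' = y \<and> Z x' y' z' = z \<and> (rad \<longrightarrow> even_gradient g x' y' z')"
    for g X Y Z
    unfolding represented_by_def
  proof (intro conjI allI impI)
    show "form_disc g = D" by (rule disc')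
    show "form_eval g x y z > 0" if nz: "(x, y, z) \<noteq> (0, 0, 0)" for x y z
      unfolding eq by (rule pos) (use inj nz in blast)
    obtain x' y' z' where "X x' y' z' = x" "Y x' y' z' = y" "Z x' y' z' = z" "rad \<longrightarrow> even_gradient g x' y' z'"
      using ex by blast
    then show "\<exists>x y z. form_eval g x y z = N \<and> (rad \<longrightarrow> even_gradient g x y z)"
      using eq xyz(1) by (intro exI[of _ x'] exI[of _ y'] exI[of _ z']) simp
  qed
  show "represented_by D rad N (b, a, c, s, r, t)"
    using disc xyz
    by (intro transfer[where X = "\<lambda>x y z. y" and Y = "\<lambda>x y z. x" and Z = "\<lambda>x y z. z"])
      (auto simp: algebra_simps)
  show "represented_by D rad N (a, c, b, r, t, s)"
    using disc xyz
    by (intro transfer[where X = "\<lambda>x y z. x" and Y = "\<lambda>x y z. z" and Z = "\<lambda>x y z. y"])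
      (auto simp: algebra_simps)
  show "represented_by D rad N (a, b, c, r, - s, - t)"
    using disc xyz
    by (intro transfer[where X = "\<lambda>x y z. - x" and Y = "\<lambda>x y z. y" and Z = "\<lambda>x y z. z"])
      (auto simp: algebra_simps intro!: exI[of _ "- x"])
  show "represented_by D rad N (a, a * k\<^sup>2 + t * k + b, c, r + s * k, s, t + 2 * a * k)"
  proof (intro transfer[where X = "\<lambda>x y z. x + k * y" and Y = "\<lambda>x y z. y" and Z = "\<lambda>x y z. z"])
    show "\<exists>x' y' z'. x' + k * y' = x \<and> y' = y \<and> z' = z \<and>
      (rad \<longrightarrow> even_gradient (a, a * k\<^sup>2 + t * k + b, c, r + s * k, s, t + 2 * a * k) x' y' z')"
    proof (intro exI conjI impI)
      show "x - k * y + k * y = x" by simp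
      assume rad
      then have g: "even (t * y + s * z)" "even (t * x + r * z)" "even (s * x + r * y)" using xyz by auto
      have "(t + 2 * a * k) * y + s * z = (t * y + s * z) + 2 * (a * k * y)"
        "(t + 2 * a * k) * (x - k * y) + (r + s * k) * z =
          (t * x + r * z) + 2 * (a * k * (x - k * y)) - k * (t * y + s * z) + 2 * (k * s * z)"
        "s * (x - k * y) + (r + s * k) * y = s * x + r * y"
        by (simp_all add: algebra_simps)
      then show "even_gradient (a, a * k\<^sup>2 + t * k + b, c, r + s * k, s, t + 2 * a * k) (x - k * y) y z"
        using g by (simp only: even_gradient.simps dvd_add dvd_diff dvd_mult dvd_triv_left simp_thms)
    qed (rule refl)+
  qed (use disc in \<open>auto simp: algebra_simps power2_eq_square\<close>)
  have "a > 0" using pos[of 1 0 0] by simp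
  \<comment> \<open>This product is the value of the form at \<open>(-t, 2 a, 0)\<close>.\<close>
  moreover have "0 < a * (4 * a * b - t\<^sup>2)"
    using pos[of "- t" "2 * a" 0] \<open>a > 0\<close> by (simp add: algebra_simps power2_eq_square)
  ultimately show "a > 0 \<and> 4 * a * b - t\<^sup>2 > 0" by (simp add: zero_less_mult_iff)
qed

text \<open>Completing squares leaves \<open>D * z^2\<close>, hence definiteness. The value
  \<open>N\<close> is taken at \<open>(1, 0, 0)\<close>, where the gradient is
  \<open>(2 N, 0, s)\<close>.\<close>

lemma represented_by_initial:
  fixes N a c h s D :: int
  assumes "N > 0" "a > 0" "D > 0" and disc: "N * (4 * a * c - h\<^sup>2) - a * s\<^sup>2 = D" and "rad \<longrightarrow> even s"
  shows "represented_by D rad N (N, a, c, h, s, 0)"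
  unfolding represented_by_def
proof (intro conjI allI impI)
  show "form_disc (N, a, c, h, s, 0) = D" using disc by (simp add: algebra_simps)
  show "\<exists>x y z. form_eval (N, a, c, h, s, 0) x y z = N \<and> (rad \<longrightarrow> even_gradient (N, a, c, h, s, 0) x y z)"
    using assms by (intro exI[of _ 1] exI[of _ 0]) simp
  fix x y z :: int assume nz: "(x, y, z) \<noteq> (0, 0, 0)"
  have eq: "4 * a * N * form_eval (N, a, c, h, s, 0) x y z =
      a * (2 * N * x + s * z)\<^sup>2 + N * (2 * a * y + h * z)\<^sup>2 + D * z\<^sup>2"
    unfolding disc[symmetric] by (simp add: algebra_simps power2_eq_square)
  have "0 < a * (2 * N * x + s * z)\<^sup>2 + N * (2 * a * y + h * z)\<^sup>2 + D * z\<^sup>2"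
  proof (cases "z = 0")
    case True
    then show ?thesis using nz assms by (cases "y = 0") (auto intro!: add_nonneg_pos)
  next
    case False
    then show ?thesis using assms by (intro add_nonneg_pos) auto
  qed
  then have "0 < (4 * a * N) * form_eval (N, a, c, h, s, 0) x y z" unfolding eq .
  then show "0 < form_eval (N, a, c, h, s, 0) x y z"
    by (rule zero_less_mult_pos) (use assms(1,2) in simp)
qed


text \<open>The ranges suffice for \<open>0 < D \<le> 31\<close> only; the coefficient \<open>c\<close> is determined by the others and \<open>D\<close>.\<close>

definition reduced_forms :: "int \<Rightarrow> form list" where
  "reduced_forms D = filter (\<lambda>f. reduced_form f \<and> form_disc f = D)
     (map (\<lambda>(a, b, t, s, r). (a, b, (D - r * s * t + a * r\<^sup>2 + b * s\<^sup>2) div (4 * a * b - t\<^sup>2), r, s, t))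
       (List.product [1..2] (List.product [1..3] (List.product [0..2] (List.product [0..2] [-3..3])))))"

text \<open>Hermite's bounds. The projected binary form has
  \<open>4 A (4 a c - s^2) - B^2 = 16 a D\<close>, and being reduced gives
  \<open>3 A^2 <= 16 a D\<close>. With \<open>3 a^2 <= A\<close> this yields
  \<open>27 a^3 <= 496\<close>, so \<open>a <= 2\<close>; then \<open>A\<close> is at most 12 for
  \<open>a = 1\<close> and 18 for \<open>a = 2\<close>, which bounds \<open>b\<close> and
  \<open>r\<close>.\<close>

lemma reduced_mem_reduced_forms:
  assumes red: "reduced_form f" and disc: "form_disc f = D" and D: "0 < D" "D \<le> 31"
  shows "f \<in> set (reduced_forms D)"
proof -
  obtain a b c r s t where f: "f = (a, b, c, r, s, t)" by (cases f) auto
  define A where "A = 4 * a * b - t\<^sup>2"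
  define B where "B = 4 * a * r - 2 * s * t"
  have a: "0 < a" "0 \<le> t" "t \<le> a" "0 \<le> s" "s \<le> a" "a \<le> b" and B: "\<bar>B\<bar> \<le> A" and C: "A \<le> 4 * a * c - s\<^sup>2"
    using red by (auto simp: f A_def B_def)
  have "t\<^sup>2 \<le> a\<^sup>2" using a by (intro power_mono) auto
  moreover have "a * a \<le> a * b" using a by (intro mult_left_mono) auto
  ultimately have A3: "3 * a\<^sup>2 \<le> A" by (simp add: A_def power2_eq_square)
  moreover have "0 < 3 * a\<^sup>2" using a by simp
  ultimately have "A > 0" by linarith
  have "4 * A * (4 * a * c - s\<^sup>2) - B\<^sup>2 = 16 * a * D"
    unfolding disc[symmetric] by (simp add: f A_def B_def algebra_simps power2_eq_square)
  moreover have "B\<^sup>2 \<le> A\<^sup>2" using B by (metis abs_le_square_iff abs_of_pos \<open>A > 0\<close>)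
  moreover have "A * A \<le> A * (4 * a * c - s\<^sup>2)" using C \<open>A > 0\<close> by (intro mult_left_mono) auto
  ultimately have "3 * A\<^sup>2 \<le> 16 * a * D" by (simp add: power2_eq_square)
  also have "16 * a * D \<le> 16 * a * 31" using D a by (intro mult_left_mono) auto
  finally have A: "3 * A\<^sup>2 \<le> 496 * a" by simp
  have "(3 * a\<^sup>2) * (3 * a\<^sup>2) \<le> A * A" using A3 \<open>A > 0\<close> by (intro mult_mono) auto
  then have "a * (27 * a ^ 3) \<le> a * 496"
    using A by (simp add: power2_eq_square power3_eq_cube algebra_simps)
  then have a3: "27 * a ^ 3 \<le> 496" using a by simp
  have "a \<le> 2"
  proof (rule ccontr)
    assume "\<not> a \<le> 2"
    then have "3 ^ 3 \<le> a ^ 3" by (intro power_mono) auto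
    then show False using a3 by simp
  qed
  then have a12: "a = 1 \<or> a = 2" using a by linarith
  have "\<not> 13 \<le> A" if "a = 1"
  proof
    assume "13 \<le> A"
    then have "13\<^sup>2 \<le> A\<^sup>2" by (intro power_mono) auto
    then show False using A that by simp
  qed
  moreover have "\<not> 19 \<le> A" if "a = 2"
  proof
    assume "19 \<le> A"
    then have "19\<^sup>2 \<le> A\<^sup>2" by (intro power_mono) auto
    then show False using A that by simp
  qed
  moreover have ts: "t \<in> {0, 1, 2}" "s \<in> {0, 1, 2}" using a \<open>a \<le> 2\<close> by auto
  ultimately have "b \<le> 3" "-3 \<le> r" "r \<le> 3"
    using a12 a B unfolding A_def B_def by (elim disjE insertE emptyE; auto)+
  then have mem: "(a, b, t, s, r) \<in> set (List.product [1..2] (List.product [1..3] (List.product [0..2] (List.product [0..2] [-3..3]))))"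
    using a \<open>a \<le> 2\<close> unfolding set_product set_upto by simp
  have "D - r * s * t + a * r\<^sup>2 + b * s\<^sup>2 = c * A"
    unfolding disc[symmetric] by (simp add: f A_def algebra_simps power2_eq_square)
  then have "c = (D - r * s * t + a * r\<^sup>2 + b * s\<^sup>2) div (4 * a * b - t\<^sup>2)"
    using \<open>A > 0\<close> by (simp add: A_def)
  then show ?thesis
    unfolding reduced_forms_def set_filter set_map
    using red disc by (intro CollectI conjI image_eqI[OF _ mem]) (simp_all add: f)
qed

subsection \<open>Rational similarities to the target forms\<close>

type_synonym vec3 = "int \<times> int \<times> int"

fun form_vec :: "form \<Rightarrow> vec3 \<Rightarrow> int" where
  "form_vec f (x, y, z) = form_eval f x y z"

fun form_polar :: "form \<Rightarrow> vec3 \<Rightarrow> vec3 \<Rightarrow> int" where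
  "form_polar (a, b, c, r, s, t) (x, y, z) (x', y', z') =
     2 * a * x * x' + 2 * b * y * y' + 2 * c * z * z' +
     r * (y * z' + z * y') + s * (x * z' + z * x') + t * (x * y' + y * x')"

fun lincomb :: "vec3 \<times> vec3 \<times> vec3 \<Rightarrow> int \<Rightarrow> int \<Rightarrow> int \<Rightarrow> vec3" where
  "lincomb ((u1, u2, u3), (v1, v2, v3), (w1, w2, w3)) x y z =
     (x * u1 + y * v1 + z * w1, x * u2 + y * v2 + z * w2, x * u3 + y * v3 + z * w3)"

fun dvd_vec :: "int \<Rightarrow> vec3 \<Rightarrow> bool" where
  "dvd_vec m (x, y, z) \<longleftrightarrow> m dvd x \<and> m dvd y \<and> m dvd z"

text \<open>The rational factor \<open>l / k\<close> is kept as two integers, so that the identity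
  of forms becomes six integer equations on the images of the basis.\<close>

fun similarity :: "form \<Rightarrow> form \<Rightarrow> vec3 \<times> vec3 \<times> vec3 \<Rightarrow> int \<Rightarrow> int \<Rightarrow> bool" where
  "similarity g (a, b, c, r, s, t) (u, v, w) k l \<longleftrightarrow>
     k * form_vec g u = l * a \<and> k * form_vec g v = l * b \<and> k * form_vec g w = l * c \<and>
     k * form_polar g v w = l * r \<and> k * form_polar g u w = l * s \<and> k * form_polar g u v = l * t"

lemma form_vec_lincomb:
  "form_vec g (lincomb (u, v, w) x y z) =
     form_vec g u * x\<^sup>2 + form_vec g v * y\<^sup>2 + form_vec g w * z\<^sup>2 +
     form_polar g v w * y * z + form_polar g u w * x * z + form_polar g u v * x * y"
  by (cases g; cases u; cases v; cases w) (simp add: power2_eq_square algebra_simps)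

lemma similarity_form_vec:
  assumes "similarity g f U k l"
  shows "k * form_vec g (lincomb U x y z) = l * form_eval f x y z"
proof -
  obtain a b c r s t u v w where f: "f = (a, b, c, r, s, t)" and U: "U = (u, v, w)"
    by (cases f; cases U) auto
  have "k * form_vec g (lincomb U x y z) =
      (k * form_vec g u) * x\<^sup>2 + (k * form_vec g v) * y\<^sup>2 + (k * form_vec g w) * z\<^sup>2 +
      (k * form_polar g v w) * y * z + (k * form_polar g u w) * x * z + (k * form_polar g u v) * x * y"
    unfolding U form_vec_lincomb by (simp add: algebra_simps)
  also have "\<dots> = l * form_eval f x y z"
    using assms by (simp add: f U power2_eq_square algebra_simps)
  finally show ?thesis .
qed

text \<open>For every reduced form \<open>f\<close> and every vector that is possible modulo \<open>2 h\<close> for a value satisfying \<open>C\<close>, some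
  matrix in \<open>Us\<close>, divided by \<open>m\<close>, is a similarity from \<open>f\<close> to \<open>g\<close> with factor \<open>l / k\<close> that takes an integral
  value there. Vectors with all coordinates even are left out because 4 does not divide the represented number.\<close>

definition covers :: "int \<Rightarrow> form \<Rightarrow> bool \<Rightarrow> (int \<Rightarrow> bool) \<Rightarrow> int \<Rightarrow> int \<Rightarrow> int \<Rightarrow> int \<Rightarrow>
    (vec3 \<times> vec3 \<times> vec3) list \<Rightarrow> bool" where
  "covers D g rad C h m k l Us \<longleftrightarrow>
     (\<forall>f\<in>set (reduced_forms D). let L = filter (\<lambda>U. similarity g f U k (l * m\<^sup>2)) Us in
       \<forall>(p, q, r)\<in>set [(0, 0, 1), (0, 1, 0), (0, 1, 1), (1, 0, 0), (1, 0, 1), (1, 1, 0), (1, 1, 1)].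
         if rad \<longrightarrow> even_gradient f p q r then
           \<forall>x\<in>set [0..h-1]. \<forall>y\<in>set [0..h-1]. \<forall>z\<in>set [0..h-1].
             if C (form_eval f (p + 2 * x) (q + 2 * y) (r + 2 * z) mod (2 * h))
             then \<exists>U\<in>set L. dvd_vec m (lincomb U (p + 2 * x) (q + 2 * y) (r + 2 * z)) else True
         else True)"

text \<open>Reduction moves the representation to a listed form. The value modulo
  \<open>2 * h\<close> and, by \<open>m dvd 2 * h\<close>, divisibility of the image by
  \<open>m\<close> depend only on the vector modulo \<open>2 * h\<close>, so the finite check
  applies to it.\<close>

lemma represents_of_covers:
  assumes cov: "covers D g rad C h m k l Us" and rep: "represented_by D rad N' f"
    and D: "0 < D" "D \<le> 31" and h: "h > 0" "m > 0" "m dvd 2 * h" and "\<not> 4 dvd N'"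
    and C: "C (N' mod (2 * h))" and N: "k \<noteq> 0" "l * N' = k * N"
  shows "represents (form_eval g) N"
proof -
  interpret form_class "represented_by D rad N'" by (rule form_class_represented_by)
  obtain f where f: "represented_by D rad N' f" "reduced_form f" using ex_reduced[OF rep] by blast
  then have mem: "f \<in> set (reduced_forms D)"
    using D by (intro reduced_mem_reduced_forms) (auto simp: represented_by_def)
  obtain x y z where xyz: "form_eval f x y z = N'" "rad \<longrightarrow> even_gradient f x y z"
    using f(1) by (auto simp: represented_by_def)
  obtain a b c r s t where abc: "f = (a, b, c, r, s, t)" by (cases f) auto
  \<comment> \<open>A residue modulo \<open>2 * h\<close> is split into parity and a residue modulo
    \<open>h\<close>, since \<open>covers\<close> tests the radical on the parity class
    first.\<close>
  have residue: "\<exists>n\<in>set [0..h-1]. [u mod 2 + 2 * n = u] (mod (2 * h))" for u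
  proof -
    have "u mod (2 * h) = u mod 2 + 2 * (u div 2 mod h)"
      using h(1) by (simp add: zmod_zmult2_eq)
    then have "[u mod 2 + 2 * (u div 2 mod h) = u] (mod (2 * h))" by (metis cong_mod_left cong_refl)
    then show ?thesis using h(1) by (intro bexI[of _ "u div 2 mod h"]) auto
  qed
  define p q e where "p = x mod 2" and "q = y mod 2" and "e = z mod 2"
  obtain x1 y1 z1 where mem1: "x1 \<in> set [0..h-1]" "y1 \<in> set [0..h-1]" "z1 \<in> set [0..h-1]"
    and cong: "[p + 2 * x1 = x] (mod (2 * h))" "[q + 2 * y1 = y] (mod (2 * h))" "[e + 2 * z1 = z] (mod (2 * h))"
    using residue[of x] residue[of y] residue[of z] unfolding p_def q_def e_def by blast
  define x' y' z' where "x' = p + 2 * x1" and "y' = q + 2 * y1" and "z' = e + 2 * z1"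
  note cong = cong[folded x'_def y'_def z'_def]
  have "[form_eval f x' y' z' = form_eval f x y z] (mod (2 * h))"
    unfolding abc form_eval.simps by (intro cong_add cong_mult cong_pow cong_refl cong)
  then have C': "C (form_eval f x' y' z' mod (2 * h))" using C xyz(1) by (simp add: Cong.cong_def)
  have rad: "rad \<longrightarrow> even_gradient f p q e"
  proof
    assume rad
    have cong_2: "[p = x] (mod 2)" "[q = y] (mod 2)" "[e = z] (mod 2)"
      by (simp_all add: p_def q_def e_def Cong.cong_def)
    have "[t * q + s * e = t * y + s * z] (mod 2)" "[t * p + r * e = t * x + r * z] (mod 2)"
        "[s * p + r * q = s * x + r * y] (mod 2)"
      by (intro cong_add cong_mult cong_refl cong_2)+
    then have "even (t * q + s * e) = even (t * y + s * z)" "even (t * p + r * e) = even (t * x + r * z)"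
        "even (s * p + r * q) = even (s * x + r * y)"
      using cong_dvd_iff by blast+
    then show "even_gradient f p q e" using xyz(2) \<open>rad\<close> by (simp only: abc even_gradient.simps simp_thms)
  qed
  have pqe: "(p, q, e) \<in> set [(0, 0, 1), (0, 1, 0), (0, 1, 1), (1, 0, 0), (1, 0, 1), (1, 1, 0), (1, 1, 1)]"
  proof -
    have "p \<in> {0, 1}" "q \<in> {0, 1}" "e \<in> {0, 1}" by (auto simp: p_def q_def e_def)
    moreover have "\<not> (p = 0 \<and> q = 0 \<and> e = 0)"
    proof
      assume "p = 0 \<and> q = 0 \<and> e = 0"
      then obtain i j n where "x = 2 * i" "y = 2 * j" "z = 2 * n"
        unfolding p_def q_def e_def by (metis mult_div_mod_eq add_0_right)
      then have "N' = 4 * form_eval f i j n"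
        unfolding xyz(1)[symmetric] abc by (simp add: power2_eq_square algebra_simps)
      then show False using \<open>\<not> 4 dvd N'\<close> by simp
    qed
    ultimately show ?thesis by auto
  qed
  let ?L = "filter (\<lambda>U. similarity g f U k (l * m\<^sup>2)) Us"
  have "\<forall>x\<in>set [0..h-1]. \<forall>y\<in>set [0..h-1]. \<forall>z\<in>set [0..h-1].
      if C (form_eval f (p + 2 * x) (q + 2 * y) (e + 2 * z) mod (2 * h))
      then \<exists>U\<in>set ?L. dvd_vec m (lincomb U (p + 2 * x) (q + 2 * y) (e + 2 * z)) else True"
    using bspec[OF bspec[OF cov[unfolded covers_def Let_def] mem] pqe] unfolding case_prod_conv if_P[OF rad] .
  then have "if C (form_eval f x' y' z' mod (2 * h)) then \<exists>U\<in>set ?L. dvd_vec m (lincomb U x' y' z') else True"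
    using mem1 unfolding x'_def y'_def z'_def by blast
  then have "\<exists>U\<in>set ?L. dvd_vec m (lincomb U x' y' z')" unfolding if_P[OF C'] .
  then obtain U where U: "similarity g f U k (l * m\<^sup>2)" "dvd_vec m (lincomb U x' y' z')" by auto
  obtain u1 u2 u3 v1 v2 v3 w1 w2 w3 where Ueq: "U = ((u1, u2, u3), (v1, v2, v3), (w1, w2, w3))"
    by (cases U) auto
  have cong_m: "[x' = x] (mod m)" "[y' = y] (mod m)" "[z' = z] (mod m)"
    using cong h(3) cong_dvd_modulus by blast+
  have "[x' * u + y' * v + z' * w = x * u + y * v + z * w] (mod m)" for u v w
    by (intro cong_add cong_mult cong_refl cong_m)
  then have "dvd_vec m (lincomb U x y z)"
    using U(2) unfolding Ueq lincomb.simps dvd_vec.simps using cong_dvd_iff by blast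
  then obtain X Y Z where XYZ: "lincomb U x y z = (m * X, m * Y, m * Z)"
    unfolding Ueq by (auto elim!: dvdE)
  have "k * form_vec g (m * X, m * Y, m * Z) = l * m\<^sup>2 * N'"
    using similarity_form_vec[OF U(1), of x y z] xyz(1) by (simp add: XYZ)
  moreover have "form_vec g (m * X, m * Y, m * Z) = m\<^sup>2 * form_eval g X Y Z"
    by (cases g) (simp add: power2_eq_square algebra_simps)
  ultimately have "(k * m\<^sup>2) * form_eval g X Y Z = m\<^sup>2 * (l * N')" by (simp only: mult_ac)
  also have "\<dots> = (k * m\<^sup>2) * N" unfolding N(2) by (simp only: mult_ac)
  finally have "(k * m\<^sup>2) * form_eval g X Y Z = (k * m\<^sup>2) * N" .
  then have "form_eval g X Y Z = N" using N(1) h(2) by simp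
  then show ?thesis by (auto simp: represents_def)
qed

section \<open>Explicit similarities for the eight targets\<close>

text \<open>Discriminant 38 against 2: the matrices have determinant 19 up to sign and pull the
  target back to 19 times a form of discriminant 2. The reduced forms are
  \<open>(1, 1, 1, 0, 1, 1)\<close> and \<open>(1, 1, 1, 1, 1, 1)\<close>, with one matrix each. As
  \<open>m = 1\<close>, integrality is automatic. The factors 31 and 37 work alike.\<close>

lemma covers_Q2a:
  "covers 2 (1, 2, 5, 0, 1, 0) False (\<lambda>_. True) 1 1 1 19
    [((1, 0, -2), (-2, -2, -1), (4, -1, -1)),
     ((1, 0, -2), (-2, -2, -1), (-3, 1, -1))]"
  by code_simp

lemma covers_Q2b:
  "covers 2 (1, 3, 6, 2, 0, 1) False (\<lambda>_. True) 1 1 1 31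
    [((1, -1, -2), (-3, 2, -2), (5, 0, -1)),
     ((1, -1, -2), (-3, 2, -2), (-4, -1, -1))]"
  by code_simp

lemma covers_Q2c:
  "covers 2 (1, 3, 7, 0, 1, 1) False (\<lambda>_. True) 1 1 1 37
    [((3, -2, -2), (-2, 1, -2), (6, 0, -1)),
     ((3, -2, -2), (-2, 1, -2), (-3, -2, -1))]"
  by code_simp

text \<open>Discriminant 45 against 5: each matrix divided by 6 is a rational isometry of
  determinant 1/3 up to sign. The reduced forms \<open>(1, 1, 2, 0, 1, 1)\<close> and
  \<open>(1, 1, 2, 1, 1, 1)\<close> get six matrices each. All-even matrices have denominator 3
  only; the others also impose a condition modulo 2.\<close>

lemma covers_Q5a:
  "covers 5 (1, 2, 7, 3, 1, 0) False (\<lambda>n. n mod 3 \<noteq> 1) 3 6 1 1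
    [((-2, 0, -2), (4, 0, -2), (-2, 6, -2)),
     ((-2, 0, -2), (-6, 0, 0), (0, -6, 0)),
     ((6, 0, 0), (4, 0, -2), (2, -6, 2)),
     ((-2, 0, -2), (2, -3, -1), (4, 5, -3)),
     ((2, -3, -1), (-2, 0, -2), (8, 2, -2)),
     ((2, -3, -1), (4, -3, 1), (6, 3, -3)),
     ((-2, 0, -2), (4, 0, -2), (0, -6, 0)),
     ((-2, 0, -2), (-6, 0, 0), (-2, 6, -2)),
     ((6, 0, 0), (4, 0, -2), (4, 6, -2)),
     ((-2, 0, -2), (2, -3, -1), (6, 3, -3)),
     ((2, -3, -1), (-2, 0, -2), (6, 3, -3)),
     ((2, -3, -1), (4, -3, 1), (8, 2, -2))]"
  by code_simp

text \<open>On radical vectors the parity is fixed, and six matrices per reduced form meet every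
  residue class modulo 3.\<close>

lemma covers_Q5a_radical:
  "covers 5 (1, 2, 7, 3, 1, 0) True odd 3 6 1 1
    [((-2, 0, -2), (4, 0, -2), (-2, 6, -2)),
     ((-2, 0, -2), (2, -3, -1), (-8, -3, 1)),
     ((-2, 0, -2), (-4, 3, -1), (6, 3, -3)),
     ((5, 3, -1), (4, 0, -2), (-2, 6, -2)),
     ((-2, 0, -2), (-6, 0, 0), (0, -6, 0)),
     ((6, 0, 0), (4, 0, -2), (2, -6, 2)),
     ((-2, 0, -2), (4, 0, -2), (0, -6, 0)),
     ((-2, 0, -2), (2, -3, -1), (6, 3, -3)),
     ((-2, 0, -2), (-4, 3, -1), (-8, -3, 1)),
     ((5, 3, -1), (4, 0, -2), (7, -3, 1)),
     ((-2, 0, -2), (-6, 0, 0), (-2, 6, -2)),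
     ((6, 0, 0), (4, 0, -2), (4, 6, -2))]"
  by code_simp

lemma covers_Q5b:
  "covers 5 (1, 2, 7, 1, 0, 0) False (\<lambda>_. True) 1 1 1 11
    [((1, -1, -1), (-2, 0, -1), (3, 2, -1)),
     ((1, -1, -1), (-2, 0, -1), (-2, -3, 0))]"
  by code_simp

text \<open>Here values divisible by 11 are divided by 11. Modulo 11 each matrix is integral on one
  isotropic line; a conic modulo 11 has twelve points, so each of the two reduced forms gets twelve
  matrices.\<close>

lemma covers_Q5b_radical:
  "covers 5 (1, 2, 7, 1, 0, 0) True (\<lambda>n. odd n \<and> 11 dvd n) 11 22 11 1
    [((2, -2, -2), (-4, 0, -2), (6, 4, -2)),
     ((2, -2, -2), (6, 1, -1), (-4, 3, -3)),
     ((4, 0, -2), (-2, -2, -2), (0, 6, -2)),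
     ((4, 0, -2), (1, -4, -1), (9, 0, 1)),
     ((4, 0, -2), (3, 4, -1), (-5, 0, -3)),
     ((4, 0, -2), (6, 2, 0), (4, -6, 0)),
     ((1, -4, -1), (4, 0, -2), (6, -4, 2)),
     ((1, -4, -1), (-3, -4, 1), (-5, 0, -3)),
     ((6, 1, -1), (2, -2, -2), (0, 6, -2)),
     ((6, 1, -1), (4, 3, 1), (6, -5, 1)),
     ((-3, 4, -1), (-4, 0, -2), (6, 4, -2)),
     ((-3, 4, -1), (1, 4, 1), (-9, 0, 1)),
     ((2, -2, -2), (-4, 0, -2), (-4, -6, 0)),
     ((2, -2, -2), (6, 1, -1), (6, -5, 1)),
     ((4, 0, -2), (-2, -2, -2), (4, -6, 0)),
     ((4, 0, -2), (1, -4, -1), (-5, 0, -3)),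
     ((4, 0, -2), (3, 4, -1), (9, 0, 1)),
     ((4, 0, -2), (6, 2, 0), (0, 6, -2)),
     ((1, -4, -1), (4, 0, -2), (-5, 0, -3)),
     ((1, -4, -1), (-3, -4, 1), (6, -4, 2)),
     ((6, 1, -1), (2, -2, -2), (6, -5, 1)),
     ((6, 1, -1), (4, 3, 1), (0, 6, -2)),
     ((-3, 4, -1), (-4, 0, -2), (-9, 0, 1)),
     ((-3, 4, -1), (1, 4, 1), (6, 4, -2))]"
  by code_simp

text \<open>Source and target have the same discriminant, so each matrix divided by 2 is a rational
  isometry of determinant 1 up to sign, and only the parity of the vector matters. The same holds
  for \<open>covers_Q31\<close>.\<close>

lemma covers_Q23:
  "covers 23 (1, 2, 5, 3, 2, 0) True odd 1 2 1 1
    [((2, 0, 0), (1, 0, -1), (1, 4, -1)),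
     ((2, 0, 0), (1, 0, -1), (2, 4, -2)),
     ((1, 0, -1), (2, 0, 0), (2, 4, -2)),
     ((2, 0, 0), (0, -2, 0), (2, 2, -2)),
     ((2, 0, 0), (0, -2, 0), (2, 1, -2)),
     ((2, 1, -1), (0, 1, -1), (2, -3, -1)),
     ((2, 1, -1), (0, 1, -1), (0, 4, 0))]"
  by code_simp

text \<open>Denominators 4 occur, so vectors are examined modulo 8; this is where the class 3 modulo
  4 of the radical is sharpened to 3 modulo 8.\<close>

lemma covers_Q29:
  "covers 29 (1, 2, 5, 3, 1, 0) True (\<lambda>n. n mod 8 = 3) 4 4 1 1
    [((4, 0, 0), (0, -4, 0), (4, 4, -4)),
     ((4, 0, 0), (0, -4, 0), (4, 2, -4)),
     ((2, 2, -2), (3, -1, -1), (9, 5, 1)),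
     ((-2, -1, -1), (0, 2, -2), (-12, 2, 2)),
     ((2, 2, -2), (3, -1, -1), (-7, -3, -3)),
     ((-2, -1, -1), (0, 2, -2), (10, -3, -3)),
     ((2, 2, -2), (-2, -2, -2), (-4, 4, 0)),
     ((2, 2, -2), (-2, -2, -2), (4, -4, 0))]"
  by code_simp

lemma covers_Q31:
  "covers 31 (1, 2, 5, 1, 2, 0) True odd 1 2 1 1
    [((2, 0, 0), (1, 0, -1), (0, 4, 0)),
     ((2, 0, 0), (1, 0, -1), (1, 4, -1)),
     ((1, 0, -1), (2, 0, 0), (1, 4, -1)),
     ((2, 0, 0), (0, -2, 0), (2, 1, -2)),
     ((2, 0, 0), (0, -2, 0), (2, 0, -2)),
     ((2, 0, 0), (2, -1, -1), (2, 3, -1)),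
     ((2, 0, 0), (2, -1, -1), (0, -3, 1))]"
  by code_simp

section \<open>Combining construction, reduction and similarities\<close>

lemma represented_radical:
  fixes N p :: nat
  assumes "prime p" "2 < p" "squarefree N" "N > 0" "odd N" "coprime N p" "4 dvd N + p"
  shows "\<exists>f. represented_by (int p) True (int N) f"
proof -
  obtain a c h s :: int where "a > 0" "int N * (4 * a * c - h\<^sup>2) - a * s\<^sup>2 = int p" "even s"
    using ex_form_odd_prime[OF assms] by blast
  then have "represented_by (int p) True (int N) (int N, a, c, h, s, 0)"
    using assms by (intro represented_by_initial) auto
  then show ?thesis by blast
qed

lemma represented_2:
  fixes N :: nat
  assumes "squarefree N" "N > 0" "odd N"
  shows "\<exists>f. represented_by 2 False (int N) f"
proof -
  obtain a c h s :: int where "a > 0" "int N * (4 * a * c - h\<^sup>2) - a * s\<^sup>2 = 2"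
    using ex_form_2[OF assms] by blast
  then have "represented_by 2 False (int N) (int N, a, c, h, s, 0)"
    using assms by (intro represented_by_initial) auto
  then show ?thesis by blast
qed

lemma represented_5:
  fixes N :: nat
  assumes "squarefree N" "N > 0" "coprime N 5"
  shows "\<exists>f. represented_by 5 False (int N) f"
proof (cases "even N \<or> N mod 4 = 1")
  case True
  obtain a c h s :: int where "a > 0" "int N * (4 * a * c - h\<^sup>2) - a * s\<^sup>2 = 5"
    using ex_form_5[OF assms True] by blast
  then have "represented_by 5 False (int N) (int N, a, c, h, s, 0)"
    using assms by (intro represented_by_initial) auto
  then show ?thesis by blast
next
  case False
  \<comment> \<open>The class left out by \<open>ex_form_5\<close> is \<open>-5\<close> modulo 4,
    exactly the one of the radical construction.\<close>
  then have "N mod 4 = 3" by presburger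
  then have "odd N" "4 dvd N + 5" by presburger+
  then obtain f where "represented_by 5 True (int N) f"
    using represented_radical[of 5 N] assms by auto
  then show ?thesis unfolding represented_by_def by blast
qed

lemma form_eval_eqs:
  "form_eval (1, 2, 5, 0, 1, 0) = Q2a" "form_eval (1, 3, 6, 2, 0, 1) = Q2b" "form_eval (1, 3, 7, 0, 1, 1) = Q2c"
  "form_eval (1, 2, 7, 3, 1, 0) = Q5a" "form_eval (1, 2, 7, 1, 0, 0) = Q5b" "form_eval (1, 2, 5, 3, 2, 0) = Q23"
  "form_eval (1, 2, 5, 3, 1, 0) = Q29" "form_eval (1, 2, 5, 1, 2, 0) = Q31"
  by (simp_all add: fun_eq_iff power2_eq_square Q2a_def Q2b_def Q2c_def Q5a_def Q5b_def Q23_def Q29_def Q31_def)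

lemma squarefree_nat: "N > 0 \<Longrightarrow> squarefree N \<Longrightarrow> squarefree (nat N)"
proof (rule squarefreeI)
  fix x assume "N > 0" "squarefree N" "x\<^sup>2 dvd nat N"
  then have "(int x)\<^sup>2 dvd N" by (metis int_dvd_int_iff nat_0_le of_nat_power order_less_imp_le)
  then have "int x dvd 1" using \<open>squarefree N\<close> by (rule squarefreeD[rotated])
  then show "x dvd 1" by simp
qed

lemma represents_radical:
  fixes N :: int and p :: nat
  assumes cov: "covers D g True C h m k l Us" and p: "D = int p" "prime p" "2 < p" "p \<le> 31"
    and N: "squarefree N" "N > 0" "odd N" "coprime N D" "[N = - D] (mod 4)"
    and h: "h > 0" "m > 0" "m dvd 2 * h" and C: "C (N mod (2 * h))"
    and N': "k \<noteq> 0" "l * N = k * N'"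
  shows "represents (form_eval g) N'"
proof -
  obtain n where n: "N = int n" using N(2) by (metis zero_less_imp_eq_int)
  have "4 dvd int n + int p" using N(5) by (simp add: n p cong_iff_dvd_diff)
  then have "4 dvd n + p" by presburger
  moreover have "squarefree n" using squarefree_nat[OF N(2,1)] by (simp add: n)
  moreover have "coprime n p" using N(4) by (simp add: n p)
  ultimately have "\<exists>f. represented_by (int p) True N f"
    using represented_radical[of p n] p N by (auto simp: n)
  then obtain f where "represented_by (int p) True N f" by blast
  moreover have "\<not> 4 dvd N" using N(3) by presburger
  ultimately show ?thesis using represents_of_covers[OF cov] p h C N' by auto
qed

theorem theorem1p8:
  fixes p N :: int
  assumes "p \<in> {2, 5, 23, 29, 31}"
    and "N > 0" and "squarefree N" and "coprime N p"
  shows "(p = 2 \<longrightarrow>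
            (19 dvd N \<longrightarrow> represents Q2a N) \<and>
            (31 dvd N \<longrightarrow> represents Q2b N) \<and>
            (37 dvd N \<longrightarrow> represents Q2c N)) \<and>
         (p = 5 \<longrightarrow>
            ([N = 0] (mod 3) \<or> [N = 2] (mod 3) \<or> [N = 3] (mod 4) \<longrightarrow> represents Q5a N) \<and>
            ([N = 0] (mod 11) \<or> [N = 1] (mod 4) \<longrightarrow> represents Q5b N)) \<and>
         (p = 23 \<longrightarrow> [N = 1] (mod 4) \<longrightarrow> represents Q23 N) \<and>
         (p = 29 \<longrightarrow> [N = 3] (mod 8) \<longrightarrow> represents Q29 N) \<and>
         (p = 31 \<longrightarrow> [N = 1] (mod 4) \<longrightarrow> represents Q31 N)"
proof -
  note N = \<open>N > 0\<close> \<open>squarefree N\<close> \<open>coprime N p\<close>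
  \<comment> \<open>\<open>n\<close> will be \<open>N\<close> itself or its quotient by 11, 19, 31
    or 37.\<close>
  have sub: "n > 0 \<and> squarefree n \<and> coprime n (nat p) \<and> \<not> 4 dvd int n" if "N = q * int n" for q n
  proof -
    have "int n dvd N" using that by simp
    have "n \<noteq> 0" using that N(1) by (intro notI) simp
    then have "n > 0" by simp
    have "squarefree (int n)" using \<open>int n dvd N\<close> N(2) squarefree_mono by blast
    then have "squarefree n" using squarefree_nat[of "int n"] \<open>n > 0\<close> by simp
    moreover have "\<not> 2\<^sup>2 dvd int n" using squarefreeD[OF \<open>squarefree (int n)\<close>, of 2] by auto
    moreover have "coprime (int n) p" using N(3) \<open>int n dvd N\<close> by (meson coprime_divisors dvd_refl)
    then have "coprime n (nat p)" using assms(1) by (metis coprime_int_iff empty_iff insertE int_nat_eq nat_0_le zero_le_numeral)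
    ultimately show ?thesis using \<open>n > 0\<close> by simp
  qed
  have quotient: "\<exists>n. N = q * int n" if q: "q dvd N" "q > 0" for q
  proof -
    obtain k where k: "N = q * k" using q(1) by (rule dvdE)
    then have "k > 0" using N(1) q(2) by (simp add: zero_less_mult_iff)
    then show ?thesis using k by (metis zero_less_imp_eq_int)
  qed
  have two: "represents (form_eval g) N"
    if "p = 2" "q dvd N" "q > 0" and cov: "covers 2 g False (\<lambda>_. True) 1 1 1 q Us" for g q Us
  proof -
    obtain n where n: "N = q * int n" using quotient[OF \<open>q dvd N\<close> \<open>q > 0\<close>] by blast
    have "n > 0" "squarefree n" "coprime n 2" "\<not> 4 dvd int n" using sub[OF n] \<open>p = 2\<close> by auto
    then obtain f where f: "represented_by 2 False (int n) f"
      using represented_2[of n] by (auto simp: coprime_right_2_iff_odd)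
    show ?thesis using represents_of_covers[OF cov f] n \<open>\<not> 4 dvd int n\<close> by simp
  qed
  show ?thesis
  proof (intro conjI impI)
    assume "p = 2"
    show "represents Q2a N" if "19 dvd N" using two[OF \<open>p = 2\<close> that _ covers_Q2a] by (simp add: form_eval_eqs)
    show "represents Q2b N" if "31 dvd N" using two[OF \<open>p = 2\<close> that _ covers_Q2b] by (simp add: form_eval_eqs)
    show "represents Q2c N" if "37 dvd N" using two[OF \<open>p = 2\<close> that _ covers_Q2c] by (simp add: form_eval_eqs)
  next
    assume "p = 5" "[N = 0] (mod 3) \<or> [N = 2] (mod 3) \<or> [N = 3] (mod 4)"
    then consider "[N = 3] (mod 4)" | "N mod 3 \<noteq> 1" by (auto simp: Cong.cong_def)
    then have "represents (form_eval (1, 2, 7, 3, 1, 0)) N"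
    proof cases
      case 1
      then have "N mod 4 = 3" by (simp add: Cong.cong_def)
      then have "odd N" "odd (N mod 6)" "[N = - 5] (mod 4)" by (presburger, presburger, simp add: Cong.cong_def)
      then show ?thesis
        using N \<open>p = 5\<close> by (intro represents_radical[OF covers_Q5a_radical, where p = 5]) auto
    next
      case 2
      then have C: "N mod (2 * 3) mod 3 \<noteq> 1" by (simp add: mod_mod_cancel)
      obtain n where n: "N = 1 * int n" using quotient[of 1] by auto
      have "n > 0" "squarefree n" "coprime n 5" "\<not> 4 dvd int n" using sub[OF n] \<open>p = 5\<close> by auto
      then obtain f where f: "represented_by 5 False (int n) f" using represented_5[of n] by auto
      show ?thesis using represents_of_covers[OF covers_Q5a f] C n \<open>\<not> 4 dvd int n\<close> by simp
    qed
    then show "represents Q5a N" by (simp add: form_eval_eqs)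
  next
    assume "p = 5" and *: "[N = 0] (mod 11) \<or> [N = 1] (mod 4)"
    have "represents (form_eval (1, 2, 7, 1, 0, 0)) N"
    proof (cases "11 dvd N")
      case True
      obtain n where n: "N = 11 * int n" using quotient[OF True] by auto
      have "n > 0" "squarefree n" "coprime n 5" "\<not> 4 dvd int n" using sub[OF n] \<open>p = 5\<close> by auto
      then obtain f where f: "represented_by 5 False (int n) f" using represented_5[of n] by auto
      show ?thesis using represents_of_covers[OF covers_Q5b f] n \<open>\<not> 4 dvd int n\<close> by simp
    next
      case False
      then have N4: "N mod 4 = 1" using * by (auto simp: Cong.cong_def cong_0_iff)
      \<comment> \<open>\<open>N = 1\<close> modulo 4 is not \<open>-5\<close>, but
        \<open>11 * N\<close> is. It remains squarefree since 11 does not divide \<open>N\<close> in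
        this case.\<close>
      have "prime (11::int)" by simp
      then have "coprime 11 N" using False by (rule prime_imp_coprime)
      then have "squarefree (11 * N)"
        using N(2) squarefree_prime[OF \<open>prime (11::int)\<close>] by (intro squarefree_mult_coprime)
      moreover have "coprime (11 * N) 5"
      proof -
        have "prime (5::int)" by simp
        then have "coprime 5 (11::int)" by (rule prime_imp_coprime) simp
        then show ?thesis using N(3) \<open>p = 5\<close> by (simp add: coprime_commute)
      qed
      moreover have "odd (11 * N)" "odd ((11 * N) mod 22)" "11 dvd (11 * N) mod 22"
        using N4 by presburger+
      moreover have "[11 * N = - 5] (mod 4)"
        using N4 unfolding Cong.cong_def by simp presburger
      ultimately show ?thesis
        using N(1) by (intro represents_radical[OF covers_Q5b_radical, where p = 5 and N = "11 * N"]) auto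
    qed
    then show "represents Q5b N" by (simp add: form_eval_eqs)
  next
    assume "p = 23" "[N = 1] (mod 4)"
    then have "N mod 4 = 1" by (simp add: Cong.cong_def)
    then have "odd N" "odd (N mod 2)" "[N = - 23] (mod 4)" by (presburger, presburger, simp add: Cong.cong_def)
    then have "represents (form_eval (1, 2, 5, 3, 2, 0)) N"
      using N \<open>p = 23\<close> by (intro represents_radical[OF covers_Q23, where p = 23]) auto
    then show "represents Q23 N" by (simp add: form_eval_eqs)
  next
    assume "p = 29" "[N = 3] (mod 8)"
    then have "N mod 8 = 3" by (simp add: Cong.cong_def)
    then have "odd N" "N mod 8 = 3" "[N = - 29] (mod 4)" unfolding Cong.cong_def by (presburger, simp, simp, presburger)
    then have "represents (form_eval (1, 2, 5, 3, 1, 0)) N"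
      using N \<open>p = 29\<close> by (intro represents_radical[OF covers_Q29, where p = 29]) auto
    then show "represents Q29 N" by (simp add: form_eval_eqs)
  next
    assume "p = 31" "[N = 1] (mod 4)"
    then have "N mod 4 = 1" by (simp add: Cong.cong_def)
    then have "odd N" "odd (N mod 2)" "[N = - 31] (mod 4)" by (presburger, presburger, simp add: Cong.cong_def)
    then have "represents (form_eval (1, 2, 5, 1, 2, 0)) N"
      using N \<open>p = 31\<close> by (intro represents_radical[OF covers_Q31, where p = 31]) auto
    then show "represents Q31 N" by (simp add: form_eval_eqs)
  qed
qed

end
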